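(* Let $N\ge2$, let $W_1,\ldots,W_N$ be invertible bounded linear operators on $\mathcal H$, and let $r_1,\ldots,r_N\in\mathbb N$ with $0\le r_1\le\cdots\le r_N$. Let $\mathcal B$ be any one of the spaces $B_0(\mathcal H)$, $B_1(\mathcal H)$, $B_2(\mathcal H)$. Then the left multipliers $L_{W_1^{r_1}},\ldots,L_{W_N^{r_N}}$ satisfy the d-hypercyclicity criterion on $\mathcal B$ if and only if $W_1^{r_1},\ldots,W_N^{r_N}$ satisfy the d-hypercyclicity criterion on $\mathcal H$.
   Context: $\mathcal H$ is a separable Hilbert space with an orthonormal basis $\{e_j\}_{j\in\mathbb N}$; $\mathbb N$ is the set of positive integers. $B(\mathcal H)$ is the set of bounded linear operators on $\mathcal H$; $B_0(\mathcal H)$, $B_1(\mathcal H)$, $B_2(\mathcal H)$ are the spaces of compact, trace class, and Hilbert–Schmidt operators on $\mathcal H$, equipped with the operator norm, trace norm, and Hilbert–Schmidt norm respectively. For $T\in B(\mathcal H)$, $L_T$ denotes the left multiplier $L_T(F):=TF$. Bounded linear operators $T_1,\ldots,T_N$ on a Banach space $\mathcal X$ satisfy the d-hypercyclicity criterion if there exist a strictly increasing sequence $\{n_k\}_{k}\subseteq\mathbb N$, dense subsets $X_0,X_1,\ldots,X_N$ of $\mathcal X$, and mappings $V_{l,k}:X_l\to\mathcal X$ ($1\le l\le N$, $k\in\mathbb N$; not assumed linear or continuous) such that, as $k\to\infty$: $T_l^{n_k}\to0$ pointwise on $X_0$ for every $l$; $V_{l,k}\to0$ pointwise on $X_l$ for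 every $l$; $T_l^{n_k}V_{s,k}\to0$ pointwise on $X_s$ whenever $s\ne l$; and $T_l^{n_k}V_{l,k}\to \mathrm{Id}_{X_l}$ pointwise on $X_l$ for every $l$. *)

theory Defs
  imports "HOL-Analysis.Analysis"
begin

text \<open>Complex Hilbert spaces. The inner product is linear in its first argument.\<close>

class complex_inner = real_normed_vector +
  fixes scaleC :: "complex \<Rightarrow> 'a \<Rightarrow> 'a"  (infixr \<open>*\<^sub>C\<close> 75)
    and cinner :: "'a \<Rightarrow> 'a \<Rightarrow> complex"
  assumes scaleC_add_right: "a *\<^sub>C (x + y) = a *\<^sub>C x + a *\<^sub>C y"
    and scaleC_add_left: "(a + b) *\<^sub>C x = a *\<^sub>C x + b *\<^sub>C x"
    and scaleC_scaleC: "a *\<^sub>C (b *\<^sub>C x) = (a * b) *\<^sub>C x"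
    and scaleC_one: "1 *\<^sub>C x = x"
    and scaleR_scaleC: "r *\<^sub>R x = complex_of_real r *\<^sub>C x"
    and cinner_commute: "cinner x y = cnj (cinner y x)"
    and cinner_add_left: "cinner (x + y) z = cinner x z + cinner y z"
    and cinner_scaleC_left: "cinner (a *\<^sub>C x) y = a * cinner x y"
    and cinner_ge_zero: "cinner x x \<in> \<real>\<^sub>\<ge>\<^sub>0"
    and norm_eq_sqrt_cinner: "norm x = sqrt (Re (cinner x x))"

class complex_hilbert = complex_inner + complete_space

global_interpretation complex_vector: vector_space "scaleC :: complex \<Rightarrow> 'a \<Rightarrow> 'a::complex_inner"
  by standard (simp_all add: scaleC_add_right scaleC_add_left scaleC_scaleC scaleC_one)

definition orthonormal_basis :: "(nat \<Rightarrow> 'h::complex_hilbert) \<Rightarrow> bool" where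
  "orthonormal_basis e \<longleftrightarrow>
     (\<forall>i j. cinner (e i) (e j) = (if i = j then 1 else 0)) \<and>
     closure (complex_vector.span (range e)) = UNIV"

text \<open>
  The type \<open>'h \<Rightarrow>\<^sub>L 'h\<close> contains all bounded real-linear maps. The bounded operators on
  the complex Hilbert space are the complex-linear ones among them.
\<close>

definition bounded_ops :: "('h::complex_hilbert \<Rightarrow>\<^sub>L 'h) set" where
  "bounded_ops = {T. \<forall>a x. blinfun_apply T (a *\<^sub>C x) = a *\<^sub>C blinfun_apply T x}"

definition invertible_op :: "('h::complex_hilbert \<Rightarrow>\<^sub>L 'h) \<Rightarrow> bool" where
  "invertible_op T \<longleftrightarrow>
     (\<exists>S\<in>bounded_ops. T o\<^sub>L S = id_blinfun \<and> S o\<^sub>L T = id_blinfun)"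

primrec op_power :: "('h::complex_hilbert \<Rightarrow>\<^sub>L 'h) \<Rightarrow> nat \<Rightarrow> ('h \<Rightarrow>\<^sub>L 'h)" where
  "op_power T 0 = id_blinfun"
| "op_power T (Suc n) = T o\<^sub>L op_power T n"

definition compact_ops :: "('h::complex_hilbert \<Rightarrow>\<^sub>L 'h) set" where
  "compact_ops = {T \<in> bounded_ops. compact (closure (blinfun_apply T ` cball 0 1))}"

definition adjoint_op :: "('h::complex_hilbert \<Rightarrow>\<^sub>L 'h) \<Rightarrow> ('h \<Rightarrow>\<^sub>L 'h)" where
  "adjoint_op T = (THE S. S \<in> bounded_ops \<and>
     (\<forall>x y. cinner (blinfun_apply T x) y = cinner x (blinfun_apply S y)))"

definition positive_op :: "('h::complex_hilbert \<Rightarrow>\<^sub>L 'h) \<Rightarrow> bool" where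
  "positive_op P \<longleftrightarrow> P \<in> bounded_ops \<and> (\<forall>x. cinner (blinfun_apply P x) x \<in> \<real>\<^sub>\<ge>\<^sub>0)"

text \<open>\<open>|T|\<close> is the unique positive square root of \<open>T\<^sup>* T\<close>.\<close>

definition abs_op :: "('h::complex_hilbert \<Rightarrow>\<^sub>L 'h) \<Rightarrow> ('h \<Rightarrow>\<^sub>L 'h)" where
  "abs_op T = (THE P. positive_op P \<and> P o\<^sub>L P = adjoint_op T o\<^sub>L T)"

text \<open>
  The next four notions are formed with respect to an orthonormal basis \<open>e\<close>; they do not
  depend on its choice. The diagonal entries of \<open>|T|\<close> are nonnegative reals, so taking
  real parts loses nothing.
\<close>

definition trace_class_ops :: "(nat \<Rightarrow> 'h::complex_hilbert) \<Rightarrow> ('h \<Rightarrow>\<^sub>L 'h) set" where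
  "trace_class_ops e =
     {T \<in> bounded_ops. summable (\<lambda>j. Re (cinner (blinfun_apply (abs_op T) (e j)) (e j)))}"

definition trace_norm :: "(nat \<Rightarrow> 'h::complex_hilbert) \<Rightarrow> ('h \<Rightarrow>\<^sub>L 'h) \<Rightarrow> real" where
  "trace_norm e T = (\<Sum>j. Re (cinner (blinfun_apply (abs_op T) (e j)) (e j)))"

definition hilbert_schmidt_ops :: "(nat \<Rightarrow> 'h::complex_hilbert) \<Rightarrow> ('h \<Rightarrow>\<^sub>L 'h) set" where
  "hilbert_schmidt_ops e =
     {T \<in> bounded_ops. summable (\<lambda>j. (norm (blinfun_apply T (e j)))\<^sup>2)}"

definition hilbert_schmidt_norm :: "(nat \<Rightarrow> 'h::complex_hilbert) \<Rightarrow> ('h \<Rightarrow>\<^sub>L 'h) \<Rightarrow> real" where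
  "hilbert_schmidt_norm e T = sqrt (\<Sum>j. (norm (blinfun_apply T (e j)))\<^sup>2)"

definition left_multiplier :: "('h::complex_hilbert \<Rightarrow>\<^sub>L 'h) \<Rightarrow> ('h \<Rightarrow>\<^sub>L 'h) \<Rightarrow> ('h \<Rightarrow>\<^sub>L 'h)" where
  "left_multiplier T F = T o\<^sub>L F"

text \<open>
  A normed space is given here by a linear subspace \<open>A\<close> of a vector space and a norm \<open>\<nu>\<close>
  on \<open>A\<close>, which need not be the norm of the surrounding type. The operators
  \<open>T 1, \<dots>, T N\<close> are bounded linear operators on \<open>(A, \<nu>)\<close>; their values outside \<open>A\<close>
  are irrelevant.
\<close>

definition dense_wrt :: "'v::real_vector set \<Rightarrow> ('v \<Rightarrow> real) \<Rightarrow> 'v set \<Rightarrow> bool" where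
  "dense_wrt A \<nu> X \<longleftrightarrow> X \<subseteq> A \<and> (\<forall>x\<in>A. \<forall>\<epsilon>>0. \<exists>y\<in>X. \<nu> (x - y) < \<epsilon>)"

definition tendsto_wrt :: "('v::real_vector \<Rightarrow> real) \<Rightarrow> (nat \<Rightarrow> 'v) \<Rightarrow> 'v \<Rightarrow> bool" where
  "tendsto_wrt \<nu> f x \<longleftrightarrow> (\<lambda>k. \<nu> (f k - x)) \<longlonglongrightarrow> 0"

definition d_hypercyclicity_criterion ::
    "'v::real_vector set \<Rightarrow> ('v \<Rightarrow> real) \<Rightarrow> nat \<Rightarrow> (nat \<Rightarrow> 'v \<Rightarrow> 'v) \<Rightarrow> bool" where
  "d_hypercyclicity_criterion A \<nu> N T \<longleftrightarrow>
     (\<exists>(n :: nat \<Rightarrow> nat) (X :: nat \<Rightarrow> 'v set) (V :: nat \<Rightarrow> nat \<Rightarrow> 'v \<Rightarrow> 'v).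
        strict_mono n \<and> (\<forall>k. n k \<ge> 1) \<and>
        (\<forall>l\<in>{0..N}. dense_wrt A \<nu> (X l)) \<and>
        (\<forall>l\<in>{1..N}. \<forall>k. V l k ` X l \<subseteq> A) \<and>
        (\<forall>l\<in>{1..N}. \<forall>x\<in>X 0. tendsto_wrt \<nu> (\<lambda>k. (T l ^^ n k) x) 0) \<and>
        (\<forall>l\<in>{1..N}. \<forall>x\<in>X l. tendsto_wrt \<nu> (\<lambda>k. V l k x) 0) \<and>
        (\<forall>l\<in>{1..N}. \<forall>s\<in>{1..N}. s \<noteq> l \<longrightarrow>
           (\<forall>x\<in>X s. tendsto_wrt \<nu> (\<lambda>k. (T l ^^ n k) (V s k x)) 0)) \<and>
        (\<forall>l\<in>{1..N}. \<forall>x\<in>X l. tendsto_wrt \<nu> (\<lambda>k. (T l ^^ n k) (V l k x)) x))"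

end

theory Submission
  imports Defs
begin

text \<open>
  Each of the three operator spaces \<open>\<B>\<close>, with its norm \<open>\<nu>\<close>, is a left ideal of the bounded
  operators on which three things hold: a column satisfies \<open>norm (F e\<^sub>0) \<le> \<nu> F\<close>; an operator
  with finitely many nonzero columns lies in \<open>\<B>\<close> and \<open>\<nu> F \<le> (\<Sum>j. norm (F e\<^sub>j))\<close>; and
  \<open>\<nu> (F - F P\<^sub>m)\<close> is arbitrarily small for suitable \<open>m\<close>, where \<open>P\<^sub>m\<close> projects onto the span of
  the first \<open>m\<close> basis vectors (locale \<open>normed_left_ideal\<close>). These properties alone yield the
  equivalence. Evaluation \<open>F \<mapsto> F e\<^sub>0\<close> is a contraction of \<open>\<B>\<close> onto the Hilbert space that
  intertwines \<open>L\<^sub>T\<close> and \<open>T\<close>, so it carries the dense sets and, after choosing preimages, the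
  maps of a criterion for the multipliers to a criterion for the operators
  (\<open>criterion_from_multipliers\<close>). Conversely, a criterion for the operators is applied column by
  column to the operators with finitely many nonzero columns, all of them taken from the given
  dense sets; these operators are dense in \<open>\<B>\<close> (\<open>criterion_to_multipliers\<close>).

  For Hilbert--Schmidt operators the properties are Minkowski's inequality and the convergence
  of a series. For compact operators, truncation converges because \<open>x\<^sub>m - P\<^sub>m x\<^sub>m\<close> tends weakly
  to \<open>0\<close> for bounded \<open>x\<^sub>m\<close>. For trace class operators everything follows from the
  characterisation of the trace norm as the supremum of \<open>Re (\<Sum>j<n. \<langle>F e\<^sub>j, C e\<^sub>j\<rangle>)\<close> over \<open>n\<close> and
  contractions \<open>C\<close> (\<open>trace_class_pairing_le\<close>, \<open>trace_class_boundI\<close>). That rests on the existence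
  of adjoints, which are built from the basis, on the existence and uniqueness of positive
  square roots, and on an approximate polar decomposition \<open>F = U |F| + \<epsilon> U\<close> with a contraction
  \<open>U = F (|F| + \<epsilon>)\<^sup>-\<^sup>1\<close>.
\<close>

section \<open>Complex inner product spaces\<close>

instance complex_hilbert \<subseteq> banach ..

lemma cinner_add_right: "cinner x (y + z) = cinner x y + cinner x (z :: 'a::complex_inner)"
  by (metis cinner_add_left cinner_commute complex_cnj_add)

lemma cinner_scaleC_right: "cinner x (a *\<^sub>C y) = cnj a * cinner x (y :: 'a::complex_inner)"
  by (metis cinner_commute cinner_scaleC_left complex_cnj_mult)

lemma cinner_scaleR_left: "cinner (r *\<^sub>R x) y = complex_of_real r * cinner x (y :: 'a::complex_inner)"
  by (simp add: scaleR_scaleC cinner_scaleC_left)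

lemma cinner_scaleR_right: "cinner x (r *\<^sub>R y) = complex_of_real r * cinner x (y :: 'a::complex_inner)"
  by (simp add: scaleR_scaleC cinner_scaleC_right)

lemma cinner_zero_left [simp]: "cinner 0 (y :: 'a::complex_inner) = 0"
  using cinner_scaleR_left[of 0 0 y] by simp

lemma cinner_zero_right [simp]: "cinner (y :: 'a::complex_inner) 0 = 0"
  using cinner_scaleR_right[of y 0 0] by simp

lemma cinner_minus_left: "cinner (- x) y = - cinner x (y :: 'a::complex_inner)"
  using cinner_scaleR_left[of "-1" x y] by simp

lemma cinner_minus_right: "cinner x (- y) = - cinner x (y :: 'a::complex_inner)"
  using cinner_scaleR_right[of x "-1" y] by simp

lemma cinner_diff_left: "cinner (x - z) y = cinner x y - cinner z (y :: 'a::complex_inner)"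
  using cinner_add_left[of x "- z" y] by (simp add: cinner_minus_left)

lemma cinner_diff_right: "cinner x (y - z) = cinner x y - cinner x (z :: 'a::complex_inner)"
  using cinner_add_right[of x y "- z"] by (simp add: cinner_minus_right)

lemma cinner_sum_left: "cinner (\<Sum>i\<in>I. f i) (y :: 'a::complex_inner) = (\<Sum>i\<in>I. cinner (f i) y)"
  by (induction I rule: infinite_finite_induct) (simp_all add: cinner_add_left)

lemma cinner_sum_right: "cinner (y :: 'a::complex_inner) (\<Sum>i\<in>I. f i) = (\<Sum>i\<in>I. cinner y (f i))"
  by (induction I rule: infinite_finite_induct) (simp_all add: cinner_add_right)

lemmas cinner_simps = cinner_add_left cinner_add_right cinner_diff_left cinner_diff_right
  cinner_scaleC_left cinner_scaleC_right cinner_scaleR_left cinner_scaleR_right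

lemma cinner_self: "cinner x x = complex_of_real ((norm (x :: 'a::complex_inner))\<^sup>2)"
proof -
  obtain t where t: "cinner x x = complex_of_real t" "t \<ge> 0"
    using cinner_ge_zero[of x] by (auto elim!: nonneg_Reals_cases)
  then show ?thesis by (simp add: norm_eq_sqrt_cinner)
qed

lemma norm_add_power2:
  "(norm (x + y))\<^sup>2 = (norm x)\<^sup>2 + 2 * Re (cinner x y) + (norm (y :: 'a::complex_inner))\<^sup>2"
proof -
  have "Re (cinner z z) = (norm z)\<^sup>2" for z :: 'a
    by (simp add: cinner_self)
  moreover have "Re (cinner y x) = Re (cinner x y)"
    by (subst cinner_commute) simp
  moreover have "Re (cinner (x + y) (x + y)) = Re (cinner x x) + Re (cinner x y) + Re (cinner y x) + Re (cinner y y)"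
    by (simp add: cinner_add_left cinner_add_right)
  ultimately show ?thesis by simp
qed

lemma norm_scaleC: "norm (a *\<^sub>C (x :: 'a::complex_inner)) = cmod a * norm x"
proof -
  have "cinner (a *\<^sub>C x) (a *\<^sub>C x) = complex_of_real ((cmod a * norm x)\<^sup>2)"
    unfolding cinner_scaleC_left cinner_scaleC_right
    using complex_norm_square[of a] by (simp add: cinner_self power_mult_distrib mult.commute)
  then have "complex_of_real ((norm (a *\<^sub>C x))\<^sup>2) = complex_of_real ((cmod a * norm x)\<^sup>2)"
    by (simp only: cinner_self)
  then have "(norm (a *\<^sub>C x))\<^sup>2 = (cmod a * norm x)\<^sup>2"
    using of_real_eq_iff by blast
  then show ?thesis by simp
qed

lemma cinner_eq_all: 
  assumes "\<And>x. cinner x y = cinner x (z :: 'a::complex_inner)" shows "y = z"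
proof -
  have "cinner (y - z) (y - z) = 0" using assms[of "y - z"] by (simp add: cinner_diff_right)
  then show ?thesis by (simp add: cinner_self)
qed

section \<open>Bounded complex-linear operators\<close>

lemma bounded_opsD: "T \<in> bounded_ops \<Longrightarrow> blinfun_apply T (a *\<^sub>C x) = a *\<^sub>C blinfun_apply T x"
  by (simp add: bounded_ops_def)

lemma bounded_ops_id: "id_blinfun \<in> bounded_ops"
  by (simp add: bounded_ops_def)

lemma bounded_ops_0: "0 \<in> bounded_ops"
  by (simp add: bounded_ops_def)

lemma bounded_ops_compose: "S \<in> bounded_ops \<Longrightarrow> T \<in> bounded_ops \<Longrightarrow> S o\<^sub>L T \<in> bounded_ops"
  by (simp add: bounded_ops_def)

lemma bounded_ops_add: "S \<in> bounded_ops \<Longrightarrow> T \<in> bounded_ops \<Longrightarrow> S + T \<in> bounded_ops"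
  by (simp add: bounded_ops_def blinfun.add_left scaleC_add_right)

lemma bounded_ops_scaleR: "T \<in> bounded_ops \<Longrightarrow> c *\<^sub>R T \<in> bounded_ops"
  by (simp add: bounded_ops_def blinfun.scaleR_left scaleR_scaleC scaleC_scaleC mult.commute)

lemma bounded_ops_diff: "S \<in> bounded_ops \<Longrightarrow> T \<in> bounded_ops \<Longrightarrow> S - T \<in> bounded_ops"
  using bounded_ops_add[of S "(-1) *\<^sub>R T"] bounded_ops_scaleR[of T "-1"] by simp

lemma bounded_ops_sum: "(\<And>i. i \<in> I \<Longrightarrow> f i \<in> bounded_ops) \<Longrightarrow> (\<Sum>i\<in>I. f i) \<in> bounded_ops"
  by (induction I rule: infinite_finite_induct) (simp_all add: bounded_ops_0 bounded_ops_add)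

lemma bounded_ops_op_power: "T \<in> bounded_ops \<Longrightarrow> op_power T n \<in> bounded_ops"
  by (induction n) (simp_all add: bounded_ops_id bounded_ops_compose)

lemma bounded_linear_scaleC: "bounded_linear (\<lambda>x :: 'a::complex_inner. a *\<^sub>C x)"
  by (rule bounded_linear_intro[where K = "cmod a"])
     (simp_all add: scaleC_add_right scaleR_scaleC scaleC_scaleC norm_scaleC mult.commute)

lemma bounded_ops_limit:
  assumes "\<And>n. S n \<in> bounded_ops" "S \<longlonglongrightarrow> T" shows "T \<in> bounded_ops"
proof -
  have "T (a *\<^sub>C x) = a *\<^sub>C T x" for a x
  proof (rule LIMSEQ_unique)
    show "(\<lambda>n. S n (a *\<^sub>C x)) \<longlonglongrightarrow> T (a *\<^sub>C x)"
      using assms(2) by (intro tendsto_intros)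
    have "(\<lambda>n. S n x) \<longlonglongrightarrow> T x" using assms(2) by (intro tendsto_intros)
    then have "(\<lambda>n. a *\<^sub>C S n x) \<longlonglongrightarrow> a *\<^sub>C T x"
      by (rule bounded_linear.tendsto[OF bounded_linear_scaleC])
    then show "(\<lambda>n. S n (a *\<^sub>C x)) \<longlonglongrightarrow> a *\<^sub>C T x"
      using assms(1) by (simp add: bounded_opsD)
  qed
  then show ?thesis by (simp add: bounded_ops_def)
qed

lemma norm_blinfun_le: "norm T \<le> c \<Longrightarrow> norm (blinfun_apply T x) \<le> c * norm x"
  by (meson mult_right_mono norm_blinfun norm_ge_zero order_trans)

section \<open>Positive operators\<close>

text \<open>Positivity of the quadratic form forces self-adjointness: the scalars are complex.\<close>

lemma positive_op_sym:
  assumes "positive_op P" shows "cinner (P x) y = cinner x (P y)"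
proof -
  have P: "P \<in> bounded_ops" and pos: "\<And>x. cinner (P x) x \<in> \<real>\<^sub>\<ge>\<^sub>0"
    using assms by (auto simp: positive_op_def)
  have real: "Im (cinner (P x) x) = 0" for x
    using pos[of x] complex_nonneg_Reals_iff by blast
  have 1: "Im (cinner (P x) y) + Im (cinner (P y) x) = 0"
    using real[of "x + y"] real[of x] real[of y]
    by (simp add: blinfun.add_right cinner_simps)
  have 2: "Re (cinner (P x) y) = Re (cinner (P y) x)"
    using real[of "x + \<i> *\<^sub>C y"] real[of x] real[of y]
    by (simp add: blinfun.add_right cinner_simps bounded_opsD[OF P])
  have "cinner (P x) y = cnj (cinner (P y) x)"
    using 1 2 by (simp add: complex_eq_iff)
  then show ?thesis by (metis cinner_commute)
qed

lemma positive_op_Re: "positive_op P \<Longrightarrow> cinner (P x) x = of_real (Re (cinner (P x) x))"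
  by (simp add: positive_op_def complex_eq_iff complex_nonneg_Reals_iff)

lemma positive_op_ge_0: "positive_op P \<Longrightarrow> Re (cinner (P x) x) \<ge> 0"
  by (simp add: positive_op_def complex_nonneg_Reals_iff)

lemma positive_opI:
  assumes "P \<in> bounded_ops" "\<And>x y. cinner (P x) y = cinner x (P y)"
    and "\<And>x. Re (cinner (P x) x) \<ge> 0"
  shows "positive_op P"
proof -
  have "Im (cinner (P x) x) = 0" for x
    using cinner_commute[of "P x" x] assms(2)[of x x]
    by (metis Im_complex_of_real Reals_cases complex_cnj_cancel_iff complex_is_Real_iff Reals_cnj_iff)
  then show ?thesis using assms by (simp add: positive_op_def complex_nonneg_Reals_iff)
qed

lemma positive_op_id: "positive_op id_blinfun"
  by (simp add: positive_op_def bounded_ops_id cinner_ge_zero)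

text \<open>The Cauchy--Schwarz inequality for the semi-inner product induced by a positive operator.\<close>

lemma positive_op_Cauchy_Schwarz:
  assumes "positive_op P"
  shows "(cmod (cinner (P x) y))\<^sup>2 \<le> Re (cinner (P x) x) * Re (cinner (P y) y)"
proof -
  have P: "P \<in> bounded_ops" using assms by (auto simp: positive_op_def)
  define a p q where "a = cinner (P x) y" and "p = Re (cinner (P x) x)" and "q = Re (cinner (P y) y)"
  have ya: "cinner (P y) x = cnj a"
    unfolding a_def by (metis assms cinner_commute positive_op_sym)
  \<comment> \<open>The form is nonnegative at \<open>x - t a y\<close>; the optimal choice is \<open>t = 1 / q\<close>.\<close>
  have quad: "0 \<le> p - 2 * t * (cmod a)\<^sup>2 + t\<^sup>2 * (cmod a)\<^sup>2 * q" for t :: real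
  proof -
    define b where "b = complex_of_real t * a"
    have "0 \<le> Re (cinner (P (x - b *\<^sub>C y)) (x - b *\<^sub>C y))"
      using assms positive_op_ge_0 by blast
    also have "cinner (P (x - b *\<^sub>C y)) (x - b *\<^sub>C y)
        = of_real p - cnj b * a - b * cnj a + b * cnj b * of_real q"
      using positive_op_Re[OF assms, of x] positive_op_Re[OF assms, of y]
      by (simp add: blinfun.diff_right bounded_opsD[OF P] cinner_simps a_def[symmetric] ya
          p_def[symmetric] q_def[symmetric] algebra_simps)
    also have "Re \<dots> = p - 2 * t * (cmod a)\<^sup>2 + t\<^sup>2 * (cmod a)\<^sup>2 * q"
      by (simp add: b_def cmod_power2) (simp add: algebra_simps power2_eq_square)
    finally show ?thesis .
  qed
  show ?thesis
  proof (cases "q = 0")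
    case True
    have "cmod a = 0"
    proof (rule ccontr)
      assume "cmod a \<noteq> 0"
      \<comment> \<open>For \<open>q = 0\<close> the bound is affine in \<open>t\<close>; at this \<open>t\<close> it equals \<open>- 1\<close>.\<close>
      then show False using quad[of "(p + 1) / (2 * (cmod a)\<^sup>2)"] positive_op_ge_0[OF assms, of x] True
        by (simp add: p_def)
    qed
    then show ?thesis using True by (simp add: a_def q_def)
  next
    case False
    then have "q > 0" using positive_op_ge_0[OF assms, of y] by (simp add: q_def less_le)
    then have "(cmod a)\<^sup>2 \<le> p * q"
      using quad[of "1 / q"] by (simp add: field_simps power2_eq_square)
    then show ?thesis by (simp add: a_def p_def q_def)
  qed
qed

lemma cinner_Cauchy_Schwarz: "cmod (cinner x y) \<le> norm x * norm (y :: 'a::complex_hilbert)"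
proof (rule power2_le_imp_le)
  show "(cmod (cinner x y))\<^sup>2 \<le> (norm x * norm y)\<^sup>2"
    using positive_op_Cauchy_Schwarz[OF positive_op_id, of x y]
    by (simp add: cinner_self power_mult_distrib)
qed simp

lemma Re_cinner_le: "Re (cinner x y) \<le> norm x * norm (y :: 'a::complex_hilbert)"
  by (meson cinner_Cauchy_Schwarz complex_Re_le_cmod order_trans)

lemma bounded_bilinear_cinner: "bounded_bilinear (cinner :: 'a::complex_hilbert \<Rightarrow> 'a \<Rightarrow> complex)"
  by (rule bounded_bilinear.intro)
     (auto simp: cinner_simps scaleR_conv_of_real cinner_Cauchy_Schwarz intro!: exI[of _ 1])

lemmas tendsto_cinner = bounded_bilinear.tendsto[OF bounded_bilinear_cinner]

text \<open>The numerical radius bounds the norm of a positive operator.\<close>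

lemma positive_op_norm_le:
  assumes "positive_op P" "\<And>x. Re (cinner (P x) x) \<le> c * (norm x)\<^sup>2" "c \<ge> 0"
  shows "norm P \<le> c"
proof (rule norm_blinfun_bound[OF assms(3)])
  fix x
  let ?y = "P x"
  have "((norm ?y)\<^sup>2)\<^sup>2 \<le> Re (cinner (P x) x) * Re (cinner (P ?y) ?y)"
    using positive_op_Cauchy_Schwarz[OF assms(1), of x ?y] by (simp add: cinner_self norm_power)
  also have "\<dots> \<le> (c * (norm x)\<^sup>2) * (c * (norm ?y)\<^sup>2)"
    by (intro mult_mono assms positive_op_ge_0 mult_nonneg_nonneg) auto
  finally have "(norm ?y)\<^sup>2 * (norm ?y)\<^sup>2 \<le> (c * norm x)\<^sup>2 * (norm ?y)\<^sup>2"
    by (simp add: power2_eq_square algebra_simps)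
  then have "(norm ?y)\<^sup>2 \<le> (c * norm x)\<^sup>2 \<or> ?y = 0"
    by (cases "?y = 0") (auto intro: mult_right_le_imp_le[of _ "(norm ?y)\<^sup>2"] simp del: mult_le_cancel_right)
  then show "norm ?y \<le> c * norm x"
    using assms(3) by (auto intro: power2_le_imp_le)
qed

lemma positive_op_zero_iff:
  assumes "positive_op P" "Re (cinner (P x) x) = 0" shows "P x = 0"
  using positive_op_Cauchy_Schwarz[OF assms(1), of x "P x"] assms(2) by (simp add: cinner_self)

section \<open>Orthonormal bases\<close>

lemma closed_under_span:
  assumes "\<And>x. x \<in> B \<Longrightarrow> P x" "P 0" "\<And>x y. P x \<Longrightarrow> P y \<Longrightarrow> P (x + y)"
    "\<And>a x. P x \<Longrightarrow> P (a *\<^sub>C x)" "x \<in> complex_vector.span B"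
  shows "P (x :: 'a::complex_inner)"
  using assms(5)
proof (induction rule: complex_vector.span_induct_alt)
  case base then show ?case using assms by simp
next
  case (step c x y) then show ?case using assms by simp
qed

text \<open>The rank-one operator \<open>x \<mapsto> \<langle>x, v\<rangle> y\<close>.\<close>

definition rank_one :: "'h::complex_hilbert \<Rightarrow> 'h \<Rightarrow> ('h \<Rightarrow>\<^sub>L 'h)" where
  "rank_one y v = Blinfun (\<lambda>x. cinner x v *\<^sub>C y)"

lemma rank_one_apply: "rank_one y v x = cinner x v *\<^sub>C y"
proof -
  have "bounded_linear (\<lambda>x. cinner x v *\<^sub>C y)"
  proof (rule bounded_linear_intro[where K = "norm v * norm y"])
    show "norm (cinner x v *\<^sub>C y) \<le> norm x * (norm v * norm y)" for x
      using mult_right_mono[OF cinner_Cauchy_Schwarz[of x v] norm_ge_zero[of y]]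
      by (simp add: norm_scaleC algebra_simps)
  qed (simp_all add: cinner_simps scaleC_add_left scaleR_scaleC scaleC_scaleC)
  then show ?thesis by (simp add: rank_one_def bounded_linear_Blinfun_apply)
qed

lemma rank_one_bounded_ops: "rank_one y v \<in> bounded_ops"
  by (simp add: bounded_ops_def rank_one_apply cinner_simps scaleC_scaleC)

text \<open>The context of a fixed orthonormal basis, indexed from \<open>0\<close>.\<close>

locale hilbert_basis =
  fixes e :: "nat \<Rightarrow> 'h::complex_hilbert"
  assumes basis: "orthonormal_basis e"
begin

lemma cinner_basis: "cinner (e i) (e j) = (if i = j then 1 else 0)"
  using basis by (simp add: orthonormal_basis_def)

lemma norm_basis [simp]: "norm (e i) = 1"
  by (simp add: norm_eq_sqrt_cinner cinner_basis)

lemma norm_basis_sum: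
  assumes "finite J"
  shows "(norm (\<Sum>j\<in>J. a j *\<^sub>C e j))\<^sup>2 = (\<Sum>j\<in>J. (cmod (a j))\<^sup>2)"
proof -
  have "complex_of_real ((norm (\<Sum>j\<in>J. a j *\<^sub>C e j))\<^sup>2)
      = (\<Sum>j\<in>J. \<Sum>i\<in>J. if i = j then a j * cnj (a j) else 0)"
    unfolding cinner_self[symmetric] cinner_sum_left cinner_sum_right
    by (intro sum.cong refl) (simp add: cinner_simps cinner_basis)
  also have "\<dots> = complex_of_real (\<Sum>j\<in>J. (cmod (a j))\<^sup>2)"
    using assms by (simp add: complex_norm_square[symmetric])
  finally show ?thesis using of_real_eq_iff by blast
qed

text \<open>The operator with \<open>e j \<mapsto> y j\<close> for \<open>j < m\<close> and \<open>e j \<mapsto> 0\<close> otherwise.\<close>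

definition cols :: "nat \<Rightarrow> (nat \<Rightarrow> 'h) \<Rightarrow> ('h \<Rightarrow>\<^sub>L 'h)" where
  "cols m y = (\<Sum>j<m. rank_one (y j) (e j))"

lemma cols_bounded_ops: "cols m y \<in> bounded_ops"
  unfolding cols_def by (intro bounded_ops_sum rank_one_bounded_ops)

lemma cols_apply: "cols m y x = (\<Sum>j<m. cinner x (e j) *\<^sub>C y j)"
  by (simp add: cols_def blinfun.sum_left rank_one_apply)

lemma cols_basis: "cols m y (e i) = (if i < m then y i else 0)"
proof -
  have "cols m y (e i) = (\<Sum>j<m. if j = i then y i else 0)"
    unfolding cols_apply by (intro sum.cong refl) (simp add: cinner_basis)
  then show ?thesis by simp
qed

text \<open>The orthogonal projection onto the span of \<open>e 0, \<dots>, e (m - 1)\<close>.\<close>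

definition proj :: "nat \<Rightarrow> ('h \<Rightarrow>\<^sub>L 'h)" where
  "proj m = cols m e"

lemma proj_bounded_ops: "proj m \<in> bounded_ops"
  by (simp add: proj_def cols_bounded_ops)

lemma proj_apply: "proj m x = (\<Sum>j<m. cinner x (e j) *\<^sub>C e j)"
  by (simp add: proj_def cols_apply)

lemma proj_basis: "proj m (e i) = (if i < m then e i else 0)"
  by (simp add: proj_def cols_basis)

lemma norm_proj_eq: "(norm (proj m x))\<^sup>2 = (\<Sum>j<m. (cmod (cinner x (e j)))\<^sup>2)"
  by (simp add: proj_apply norm_basis_sum)

lemma proj_sym: "cinner (proj m x) y = cinner x (proj m y)"
proof -
  have "cinner (e j) y = cnj (cinner y (e j))" for j
    by (rule cinner_commute)
  then show ?thesis
    by (simp add: proj_apply cinner_sum_left cinner_sum_right cinner_simps mult.commute)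
qed

lemma proj_idem: "proj m (proj m x) = proj m x"
proof -
  have "proj m (\<Sum>j<m. cinner x (e j) *\<^sub>C e j) = (\<Sum>j<m. cinner x (e j) *\<^sub>C e j)"
    unfolding blinfun.sum_right bounded_opsD[OF proj_bounded_ops] proj_basis
    by (intro sum.cong refl) auto
  then show ?thesis unfolding proj_apply[of m x] .
qed

lemma norm_proj_decomp: "(norm x)\<^sup>2 = (norm (proj m x))\<^sup>2 + (norm (x - proj m x))\<^sup>2"
proof -
  have "cinner (proj m x) (proj m x) = cinner x (proj m x)"
    by (simp only: proj_sym proj_idem)
  moreover have "cinner (proj m x) x = cinner x (proj m x)" by (rule proj_sym)
  ultimately have "cinner x x
      = cinner (proj m x) (proj m x) + cinner (x - proj m x) (x - proj m x)"
    by (simp only: cinner_diff_left cinner_diff_right) simp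
  then have "complex_of_real ((norm x)\<^sup>2)
      = of_real ((norm (proj m x))\<^sup>2 + (norm (x - proj m x))\<^sup>2)"
    by (simp only: cinner_self of_real_add)
  then show ?thesis using of_real_eq_iff by blast
qed

lemma norm_proj_le: "norm (proj m x) \<le> norm x"
  by (rule power2_le_imp_le) (unfold norm_proj_decomp[of x m], simp_all)

lemma norm_diff_proj_le: "norm (x - proj m x) \<le> norm x"
  by (rule power2_le_imp_le) (unfold norm_proj_decomp[of x m], simp_all)

text \<open>The set of \<open>x\<close> for which the expansion converges to \<open>x\<close> is a closed subspace.\<close>

lemma proj_tendsto: "(\<lambda>m. proj m x) \<longlonglongrightarrow> x"
proof -
  have sp: "(\<lambda>m. proj m y) \<longlonglongrightarrow> y" if "y \<in> complex_vector.span (range e)" for y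
  proof (rule closed_under_span[OF _ _ _ _ that])
    fix x assume "x \<in> range e"
    then obtain i where i: "x = e i" by auto
    have "eventually (\<lambda>m. proj m x = x) sequentially"
      using eventually_gt_at_top[of i] by eventually_elim (simp add: i proj_basis)
    then show "(\<lambda>m. proj m x) \<longlonglongrightarrow> x" by (rule tendsto_eventually)
  next
    fix a x assume "(\<lambda>m. proj m x) \<longlonglongrightarrow> x"
    then show "(\<lambda>m. proj m (a *\<^sub>C x)) \<longlonglongrightarrow> a *\<^sub>C x"
      using bounded_linear.tendsto[OF bounded_linear_scaleC]
      by (simp add: bounded_opsD[OF proj_bounded_ops])
  qed (simp_all add: blinfun.add_right tendsto_add)
  show ?thesis
  proof (rule LIMSEQ_I)
    fix r :: real assume "r > 0"
    have "x \<in> closure (complex_vector.span (range e))"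
      using basis by (simp add: orthonormal_basis_def)
    then obtain y where y: "y \<in> complex_vector.span (range e)" "dist y x < r / 2"
      using \<open>r > 0\<close> by (meson closure_approachable half_gt_zero)
    obtain k where k: "\<And>m. m \<ge> k \<Longrightarrow> norm (proj m y - y) < r / 2"
      using LIMSEQ_D[OF sp[OF y(1)], of "r / 2"] \<open>r > 0\<close> by auto
    have "norm (proj m x - x) < r" if "m \<ge> k" for m
    proof -
      have "proj m x - x = (proj m y - y) - ((x - y) - proj m (x - y)) "
        by (simp add: blinfun.diff_right)
      then have "norm (proj m x - x) \<le> norm (proj m y - y) + norm ((x - y) - proj m (x - y))"
        by (metis norm_triangle_ineq4)
      also have "\<dots> < r / 2 + r / 2"
        using k[OF that] norm_diff_proj_le[of "x - y" m] y(2)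
        by (intro add_less_le_mono) (auto simp: dist_norm norm_minus_commute)
      finally show ?thesis by simp
    qed
    then show "\<exists>k. \<forall>m\<ge>k. norm (proj m x - x) < r" by blast
  qed
qed

lemma Parseval: "(\<lambda>j. (cmod (cinner x (e j)))\<^sup>2) sums (norm x)\<^sup>2"
  unfolding sums_def norm_proj_eq[symmetric] by (intro tendsto_intros proj_tendsto)

lemma Bessel: "finite J \<Longrightarrow> (\<Sum>j\<in>J. (cmod (cinner x (e j)))\<^sup>2) \<le> (norm x)\<^sup>2"
  using sum_le_suminf[OF sums_summable[OF Parseval], of J x] sums_unique[OF Parseval, of x] by simp

lemma cmod_cinner_basis_le: "cmod (cinner x (e j)) \<le> norm x"
  using cinner_Cauchy_Schwarz[of x "e j"] by simp

lemma bounded_ops_finite_cols: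
  assumes "F \<in> bounded_ops" "\<And>j. j \<ge> m \<Longrightarrow> F (e j) = 0"
  shows "F = cols m (\<lambda>j. F (e j))"
proof (rule blinfun_eqI, rule LIMSEQ_unique)
  fix x
  show "(\<lambda>n. F (proj n x)) \<longlonglongrightarrow> F x"
    by (intro tendsto_intros proj_tendsto)
  have "F (proj n x) = cols m (\<lambda>j. F (e j)) x" if "n \<ge> m" for n
  proof -
    have "F (proj n x) = (\<Sum>j<n. cinner x (e j) *\<^sub>C F (e j))"
      by (simp add: proj_apply blinfun.sum_right bounded_opsD[OF assms(1)])
    also have "\<dots> = (\<Sum>j<m. cinner x (e j) *\<^sub>C F (e j))"
      using that assms(2) by (intro sum.mono_neutral_right) auto
    finally show ?thesis by (simp add: cols_apply)
  qed
  then have "eventually (\<lambda>n. F (proj n x) = cols m (\<lambda>j. F (e j)) x) sequentially"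
    using eventually_sequentially by blast
  then show "(\<lambda>n. F (proj n x)) \<longlonglongrightarrow> cols m (\<lambda>j. F (e j)) x"
    by (rule tendsto_eventually)
qed

lemma norm_cols_le: "norm (cols m y) \<le> (\<Sum>j<m. norm (y j))"
proof (rule norm_blinfun_bound)
  fix x
  have "norm (cols m y x) \<le> (\<Sum>j<m. norm (cinner x (e j) *\<^sub>C y j))"
    unfolding cols_apply by (rule norm_sum)
  also have "\<dots> \<le> (\<Sum>j<m. norm (y j) * norm x)"
    unfolding norm_scaleC mult.commute[of "norm (y _)"]
    by (intro sum_mono mult_right_mono cmod_cinner_basis_le) auto
  finally show "norm (cols m y x) \<le> (\<Sum>j<m. norm (y j)) * norm x"
    by (simp add: sum_distrib_right)
qed (simp add: sum_nonneg)

lemma sum_norm_cols_le: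
  assumes "\<And>j. j \<ge> m \<Longrightarrow> blinfun_apply F (e j) = 0"
  shows "(\<Sum>j<n. norm (F (e j))) \<le> (\<Sum>j<m. norm (F (e j)))"
proof -
  have "(\<Sum>j<n. norm (F (e j))) = (\<Sum>j\<in>{..<n} \<inter> {..<m}. norm (F (e j)))"
    using assms by (intro sum.mono_neutral_right) (auto simp: not_less[symmetric])
  also have "\<dots> \<le> (\<Sum>j<m. norm (F (e j)))" by (intro sum_mono2) auto
  finally show ?thesis .
qed

section \<open>Adjoints\<close>

text \<open>The adjoint is obtained coordinatewise: \<open>T\<^sup>* y = \<Sum>i. \<langle>y, T e\<^sub>i\<rangle> e\<^sub>i\<close>.\<close>

lemma adjoint_vector_exists:
  fixes T :: "'h \<Rightarrow>\<^sub>L 'h"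
  assumes "T \<in> bounded_ops" shows "\<exists>z. \<forall>x. cinner (T x) y = cinner x z"
proof -
  define a where "a i = cinner y (T (e i))" for i
  define s where "s m = (\<Sum>i<m. a i *\<^sub>C e i)" for m
  have norm_s: "(norm (s m))\<^sup>2 = (\<Sum>i<m. (cmod (a i))\<^sup>2)" for m
    by (simp add: s_def norm_basis_sum)
  have s: "cinner x (s m) = cinner (T (proj m x)) y" for x m
  proof -
    have "cnj (a i) = cinner (T (e i)) y" for i
      unfolding a_def by (rule cinner_commute[symmetric])
    then show ?thesis
      by (simp add: s_def cinner_sum_right proj_apply blinfun.sum_right cinner_sum_left
        bounded_opsD[OF assms] cinner_simps mult.commute)
  qed
  have "norm (s m) \<le> norm T * norm y" for m
  proof (cases "s m = 0")
    case False
    have "(norm (s m))\<^sup>2 = Re (cinner (s m) (s m))" by (simp add: cinner_self)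
    also have "\<dots> \<le> norm (T (proj m (s m))) * norm y"
      unfolding s by (rule Re_cinner_le)
    also have "\<dots> \<le> (norm T * norm (s m)) * norm y"
      by (meson mult_left_mono mult_right_mono norm_blinfun norm_ge_zero norm_proj_le order_trans)
    finally show ?thesis using False by (simp add: power2_eq_square)
  qed simp
  then have "(\<Sum>i<m. (cmod (a i))\<^sup>2) \<le> (norm T * norm y)\<^sup>2" for m
    unfolding norm_s[symmetric] by (intro power_mono) auto
  then have sum: "summable (\<lambda>i. (cmod (a i))\<^sup>2)"
    by (intro bounded_imp_summable[where B = "(norm T * norm y)\<^sup>2"])
       (simp_all only: lessThan_Suc_atMost[symmetric], simp)
  have "summable (\<lambda>i. a i *\<^sub>C e i)"
    unfolding summable_Cauchy
  proof (intro allI impI)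
    fix r :: real assume "r > 0"
    then have "r\<^sup>2 > 0" by simp
    then obtain K where K: "\<And>m n. m \<ge> K \<Longrightarrow> norm (\<Sum>i=m..<n. (cmod (a i))\<^sup>2) < r\<^sup>2"
      using sum unfolding summable_Cauchy by blast
    have "norm (\<Sum>i=m..<n. a i *\<^sub>C e i) < r" if "m \<ge> K" for m n
      using K[OF that, of n] \<open>r > 0\<close>
      by - (rule power_less_imp_less_base[where n = 2], auto simp: norm_basis_sum sum_nonneg)
    then show "\<exists>K. \<forall>m\<ge>K. \<forall>n. norm (\<Sum>i=m..<n. a i *\<^sub>C e i) < r" by blast
  qed
  then obtain z where z: "s \<longlonglongrightarrow> z"
    unfolding s_def summable_def sums_def by blast
  have "cinner (T x) y = cinner x z" for x
  proof (rule LIMSEQ_unique)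
    show "(\<lambda>m. cinner x (s m)) \<longlonglongrightarrow> cinner x z"
      by (intro tendsto_cinner tendsto_const z)
    show "(\<lambda>m. cinner x (s m)) \<longlonglongrightarrow> cinner (T x) y"
      unfolding s by (intro tendsto_cinner tendsto_intros proj_tendsto)
  qed
  then show ?thesis by blast
qed

lemma adjoint_exists:
  fixes T :: "'h \<Rightarrow>\<^sub>L 'h"
  assumes T: "T \<in> bounded_ops"
  shows "\<exists>S\<in>bounded_ops. \<forall>x y. cinner (T x) y = cinner x (S y)"
proof -
  obtain f where f: "\<And>x y. cinner (T x) y = cinner x (f y)"
    using adjoint_vector_exists[OF T] by metis
  have scale: "f (c *\<^sub>C y) = c *\<^sub>C f y" for c y
    by (rule cinner_eq_all) (simp add: f[symmetric] cinner_simps)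
  have "bounded_linear f"
  proof (rule bounded_linear_intro[where K = "norm T"])
    show "f (x + y) = f x + f y" for x y
      by (rule cinner_eq_all) (simp add: f[symmetric] cinner_simps)
    show "f (r *\<^sub>R y) = r *\<^sub>R f y" for r y
      by (simp add: scaleR_scaleC scale)
    show "norm (f y) \<le> norm y * norm T" for y
    proof (cases "f y = 0")
      case False
      have "(norm (f y))\<^sup>2 = Re (cinner (T (f y)) y)" by (simp add: f cinner_self)
      also have "\<dots> \<le> norm (T (f y)) * norm y" by (rule Re_cinner_le)
      also have "\<dots> \<le> (norm T * norm (f y)) * norm y"
        by (meson mult_right_mono norm_blinfun norm_ge_zero)
      finally show ?thesis using False by (simp add: power2_eq_square mult.commute)
    qed simp
  qed
  then have "blinfun_apply (Blinfun f) = f" by (simp add: bounded_linear_Blinfun_apply)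
  then show ?thesis using f scale by (intro bexI[of _ "Blinfun f"]) (auto simp: bounded_ops_def)
qed

lemma adjoint_op:
  fixes T :: "'h \<Rightarrow>\<^sub>L 'h"
  assumes "T \<in> bounded_ops"
  shows adjoint_op_bounded_ops: "adjoint_op T \<in> bounded_ops"
    and adjoint_op_cinner: "cinner (T x) y = cinner x (adjoint_op T y)"
proof -
  have "\<exists>!S. S \<in> bounded_ops \<and> (\<forall>x y. cinner (T x) y = cinner x (blinfun_apply S y))"
  proof (rule ex_ex1I)
    show "\<exists>S. S \<in> bounded_ops \<and> (\<forall>x y. cinner (T x) y = cinner x (S y))"
      using adjoint_exists[OF assms] by blast
    show "S = S'" if "S \<in> bounded_ops \<and> (\<forall>x y. cinner (T x) y = cinner x (S y))"
      "S' \<in> bounded_ops \<and> (\<forall>x y. cinner (T x) y = cinner x (S' y))" for S S' :: "'h \<Rightarrow>\<^sub>L 'h"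
      using that by (intro blinfun_eqI cinner_eq_all) metis
  qed
  from theI'[OF this] show "adjoint_op T \<in> bounded_ops" 
    and "cinner (T x) y = cinner x (adjoint_op T y)"
    unfolding adjoint_op_def by blast+
qed

lemma norm_adjoint_le:
  fixes T :: "'h \<Rightarrow>\<^sub>L 'h"
  assumes "T \<in> bounded_ops" shows "norm (adjoint_op T) \<le> norm T"
proof (rule norm_blinfun_bound)
  fix y let ?z = "adjoint_op T y"
  show "norm ?z \<le> norm T * norm y"
  proof (cases "?z = 0")
    case False
    have "(norm ?z)\<^sup>2 = Re (cinner (T ?z) y)" by (simp add: adjoint_op_cinner[OF assms] cinner_self)
    also have "\<dots> \<le> norm (T ?z) * norm y" by (rule Re_cinner_le)
    also have "\<dots> \<le> (norm T * norm ?z) * norm y"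
      by (meson mult_right_mono norm_blinfun norm_ge_zero)
    finally show ?thesis using False by (simp add: power2_eq_square mult.commute mult.left_commute)
  qed simp
qed simp

end

section \<open>Square roots and resolvents of positive operators\<close>

text \<open>
  The iteration \<open>Y (n + 1) = (X + Y n \<circ> Y n) / 2\<close> converges in norm whenever
  \<open>norm X \<le> 1\<close>: its increments are dominated by those of the same iteration for the scalar
  \<open>X = 1\<close>, which increases to \<open>1\<close>. If \<open>Y\<close> is the limit, then \<open>1 - Y\<close> is a square root of \<open>1 - X\<close>.
\<close>

primrec sqrt_iter :: "('h::complex_hilbert \<Rightarrow>\<^sub>L 'h) \<Rightarrow> nat \<Rightarrow> ('h \<Rightarrow>\<^sub>L 'h)" where
  "sqrt_iter X 0 = 0"
| "sqrt_iter X (Suc n) = (1/2) *\<^sub>R (X + (sqrt_iter X n o\<^sub>L sqrt_iter X n))"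

text \<open>The scalar iteration for \<open>X = 1\<close>, which majorises the increments of \<open>sqrt_iter\<close>.\<close>

primrec sqrt_iter_real :: "nat \<Rightarrow> real" where
  "sqrt_iter_real 0 = 0"
| "sqrt_iter_real (Suc n) = (1/2) * (1 + (sqrt_iter_real n)\<^sup>2)"

lemma sqrt_iter_real_bounds: "0 \<le> sqrt_iter_real n \<and> sqrt_iter_real n \<le> 1"
proof (induction n)
  case (Suc n)
  then have "(sqrt_iter_real n)\<^sup>2 \<le> 1" by (simp add: power_le_one)
  then show ?case by simp
qed simp

lemma sqrt_iter_real_summable: "summable (\<lambda>n. sqrt_iter_real (Suc n) - sqrt_iter_real n)"
proof -
  have "incseq sqrt_iter_real"
  proof (rule incseq_SucI)
    fix n
    have "0 \<le> (1 - sqrt_iter_real n)\<^sup>2" by simp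
    then show "sqrt_iter_real n \<le> sqrt_iter_real (Suc n)"
      by (simp add: power2_eq_square algebra_simps)
  qed
  then obtain L where "sqrt_iter_real \<longlonglongrightarrow> L"
    using incseq_convergent[of sqrt_iter_real 1] sqrt_iter_real_bounds by blast
  then show ?thesis by (rule telescope_summable)
qed

lemma sqrt_iter_commute:
  assumes "R o\<^sub>L X = X o\<^sub>L R" shows "R o\<^sub>L sqrt_iter X n = sqrt_iter X n o\<^sub>L R"
proof (induction n)
  case (Suc n)
  have IH: "R (sqrt_iter X n x) = sqrt_iter X n (R x)" for x
    using Suc by (metis blinfun_apply_blinfun_compose)
  have "R (X x) = X (R x)" for x
    using assms by (metis blinfun_apply_blinfun_compose)
  then show ?case by (intro blinfun_eqI) (simp add: blinfun.bilinear_simps IH)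
qed simp

lemma sqrt_iter_self_commute: "sqrt_iter X m o\<^sub>L sqrt_iter X n = sqrt_iter X n o\<^sub>L sqrt_iter X m"
  by (intro sqrt_iter_commute sqrt_iter_commute[symmetric] refl)

lemma norm_sqrt_iter_le:
  assumes "norm X \<le> 1" shows "norm (sqrt_iter X n) \<le> sqrt_iter_real n"
proof (induction n)
  case (Suc n)
  have "norm (sqrt_iter X n o\<^sub>L sqrt_iter X n) \<le> (sqrt_iter_real n)\<^sup>2"
    unfolding power2_eq_square
    by (rule order_trans[OF norm_blinfun_compose]) (intro mult_mono Suc, auto simp: sqrt_iter_real_bounds)
  then have "norm (X + (sqrt_iter X n o\<^sub>L sqrt_iter X n)) \<le> 1 + (sqrt_iter_real n)\<^sup>2"
    by (rule norm_triangle_mono[OF assms])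
  then show ?case by simp
qed simp

lemma norm_sqrt_iter_diff_le:
  assumes "norm X \<le> 1"
  shows "norm (sqrt_iter X (Suc n) - sqrt_iter X n) \<le> sqrt_iter_real (Suc n) - sqrt_iter_real n"
proof (induction n)
  case 0
  then show ?case using assms by simp
next
  case (Suc n)
  let ?Y = "sqrt_iter X n" and ?Z = "sqrt_iter X (Suc n)"
  let ?y = "sqrt_iter_real n" and ?z = "sqrt_iter_real (Suc n)"
  have comm: "?Y (?Z x) = ?Z (?Y x)" for x
    using sqrt_iter_self_commute[of X n "Suc n"] by (metis blinfun_apply_blinfun_compose)
  have "sqrt_iter X (Suc (Suc n)) - ?Z = (1/2) *\<^sub>R ((X + (?Z o\<^sub>L ?Z)) - (X + (?Y o\<^sub>L ?Y)))"
    by (simp only: sqrt_iter.simps scaleR_diff_right)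
  also have "(X + (?Z o\<^sub>L ?Z)) - (X + (?Y o\<^sub>L ?Y)) = (?Z + ?Y) o\<^sub>L (?Z - ?Y)"
    by (intro blinfun_eqI) (simp only: blinfun.bilinear_simps blinfun_apply_blinfun_compose comm, simp)
  finally have "norm (sqrt_iter X (Suc (Suc n)) - ?Z) = (1/2) * norm ((?Z + ?Y) o\<^sub>L (?Z - ?Y))"
    by simp
  also have "\<dots> \<le> (1/2) * ((?z + ?y) * (?z - ?y))"
    by (intro mult_left_mono order_trans[OF norm_blinfun_compose] mult_mono Suc.IH
        norm_triangle_mono norm_sqrt_iter_le assms)
       (use sqrt_iter_real_bounds[of n] sqrt_iter_real_bounds[of "Suc n"] in auto)
  also have "\<dots> = sqrt_iter_real (Suc (Suc n)) - ?z"
    by (simp only: sqrt_iter_real.simps(2)[of "Suc n"]) (simp add: power2_eq_square algebra_simps)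
  finally show ?case .
qed

lemma sqrt_iter_convergent:
  assumes "norm X \<le> 1" shows "\<exists>Y. sqrt_iter X \<longlonglongrightarrow> Y"
proof -
  have "summable (\<lambda>n. sqrt_iter X (Suc n) - sqrt_iter X n)"
    by (rule summable_comparison_test'[OF sqrt_iter_real_summable, of 0])
       (rule norm_sqrt_iter_diff_le[OF assms])
  then have "convergent (\<lambda>n. \<Sum>k<n. sqrt_iter X (Suc k) - sqrt_iter X k)"
    by (simp add: summable_iff_convergent)
  then show ?thesis by (simp add: sum_lessThan_telescope convergent_def del: sqrt_iter.simps(2))
qed

lemma positive_op_bounded_ops: "positive_op P \<Longrightarrow> P \<in> bounded_ops"
  by (simp add: positive_op_def)

lemma positive_op_scaleR:
  assumes "positive_op P" "c \<ge> 0" shows "positive_op (c *\<^sub>R P)"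
  using assms
  by - (rule positive_opI, simp_all add: bounded_ops_scaleR positive_op_bounded_ops
    blinfun.scaleR_left cinner_simps positive_op_sym[symmetric] positive_op_ge_0)

lemma Re_cinner_le_norm:
  fixes P :: "'h::complex_hilbert \<Rightarrow>\<^sub>L 'h"
  shows "Re (cinner (blinfun_apply P x) x) \<le> norm P * (norm x)\<^sup>2"
proof -
  have "Re (cinner (P x) x) \<le> norm (P x) * norm x" by (rule Re_cinner_le)
  also have "\<dots> \<le> norm P * norm x * norm x" by (meson mult_right_mono norm_blinfun norm_ge_zero)
  finally show ?thesis by (simp add: power2_eq_square mult.assoc)
qed

text \<open>
  The square root commutes with everything that commutes with the operator; this gives
  uniqueness below.
\<close>

lemma positive_sqrt_exists_contraction:
  assumes A: "positive_op A" "norm A \<le> 1"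
  shows "\<exists>S. positive_op S \<and> S o\<^sub>L S = A \<and> (\<forall>R. R o\<^sub>L A = A o\<^sub>L R \<longrightarrow> R o\<^sub>L S = S o\<^sub>L R)"
proof -
  define X where "X = id_blinfun - A"
  have Ab: "A \<in> bounded_ops" using A by (simp add: positive_op_def)
  have Xb: "X \<in> bounded_ops" by (simp add: X_def bounded_ops_diff bounded_ops_id Ab)
  have Xsym: "cinner (X x) y = cinner x (X y)" for x y
    by (simp add: X_def blinfun.bilinear_simps cinner_simps positive_op_sym[OF A(1)])
  have XR: "Re (cinner (X x) x) = (norm x)\<^sup>2 - Re (cinner (A x) x)" for x
    by (simp add: X_def blinfun.bilinear_simps cinner_simps cinner_self)
  have "Re (cinner (A x) x) \<le> (norm x)\<^sup>2" for x
    using Re_cinner_le_norm[of A x] mult_right_mono[OF A(2), of "(norm x)\<^sup>2"] by simp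
  then have "positive_op X" by (intro positive_opI Xb Xsym) (simp add: XR)
  then have X1: "norm X \<le> 1"
    by (rule positive_op_norm_le) (simp_all add: XR positive_op_ge_0[OF A(1)])
  obtain Y where Y: "sqrt_iter X \<longlonglongrightarrow> Y" using sqrt_iter_convergent[OF X1] by blast
  have "(\<lambda>n. sqrt_iter X (Suc n)) \<longlonglongrightarrow> (1/2) *\<^sub>R (X + (Y o\<^sub>L Y))"
    unfolding sqrt_iter.simps
    by (intro tendsto_intros bounded_bilinear.tendsto[OF bounded_bilinear_blinfun_compose] Y)
  then have YY: "Y = (1/2) *\<^sub>R (X + (Y o\<^sub>L Y))"
    using LIMSEQ_Suc[OF Y] LIMSEQ_unique by blast
  have iter_b: "sqrt_iter X n \<in> bounded_ops" for n
    by (induction n) (simp_all add: bounded_ops_0 bounded_ops_scaleR bounded_ops_add Xb bounded_ops_compose)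
  have Yb: "Y \<in> bounded_ops" by (rule bounded_ops_limit[OF iter_b Y])
  have iter_sym: "cinner (sqrt_iter X n x) y = cinner x (sqrt_iter X n y)" for n x y
    by (induction n arbitrary: x y) (simp_all add: blinfun.bilinear_simps cinner_simps Xsym)
  have Ysym: "cinner (Y x) y = cinner x (Y y)" for x y
  proof (rule LIMSEQ_unique)
    show "(\<lambda>n. cinner (sqrt_iter X n x) y) \<longlonglongrightarrow> cinner (Y x) y"
      by (intro tendsto_cinner tendsto_intros Y)
    show "(\<lambda>n. cinner (sqrt_iter X n x) y) \<longlonglongrightarrow> cinner x (Y y)"
      unfolding iter_sym by (intro tendsto_cinner tendsto_intros Y)
  qed
  have Y1: "norm Y \<le> 1"
    using norm_sqrt_iter_le[OF X1] sqrt_iter_real_bounds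
    by (intro tendsto_upperbound[OF tendsto_norm[OF Y]]) (auto intro: order_trans always_eventually)
  define S where "S = id_blinfun - Y"
  have "positive_op S"
  proof (rule positive_opI)
    show "S \<in> bounded_ops" by (simp add: S_def bounded_ops_diff bounded_ops_id Yb)
    show "cinner (S x) y = cinner x (S y)" for x y
      by (simp add: S_def blinfun.bilinear_simps cinner_simps Ysym)
    show "0 \<le> Re (cinner (S x) x)" for x
      using Re_cinner_le_norm[of Y x] mult_right_mono[OF Y1, of "(norm x)\<^sup>2"]
      by (simp add: S_def blinfun.bilinear_simps cinner_simps cinner_self)
  qed
  moreover have "S o\<^sub>L S = A"
  proof (rule blinfun_eqI)
    fix x
    have "2 *\<^sub>R Y x = X x + Y (Y x)"
      by (subst YY) (simp add: blinfun.bilinear_simps)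
    then show "(S o\<^sub>L S) x = A x"
      by (simp add: S_def X_def blinfun.bilinear_simps scaleR_2 algebra_simps)
  qed
  moreover have "R o\<^sub>L S = S o\<^sub>L R" if "R o\<^sub>L A = A o\<^sub>L R" for R
  proof -
    have RA: "R (A x) = A (R x)" for x using that by (metis blinfun_apply_blinfun_compose)
    have RX: "R o\<^sub>L X = X o\<^sub>L R"
      by (intro blinfun_eqI) (simp add: X_def blinfun.bilinear_simps RA)
    have "R o\<^sub>L Y = Y o\<^sub>L R"
    proof (rule LIMSEQ_unique)
      show "(\<lambda>n. R o\<^sub>L sqrt_iter X n) \<longlonglongrightarrow> (R o\<^sub>L Y)"
        by (intro bounded_bilinear.tendsto[OF bounded_bilinear_blinfun_compose] tendsto_intros Y)
      show "(\<lambda>n. R o\<^sub>L sqrt_iter X n) \<longlonglongrightarrow> (Y o\<^sub>L R)"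
        unfolding sqrt_iter_commute[OF RX]
        by (intro bounded_bilinear.tendsto[OF bounded_bilinear_blinfun_compose] tendsto_intros Y)
    qed
    then have "R (Y x) = Y (R x)" for x by (metis blinfun_apply_blinfun_compose)
    then show ?thesis by (intro blinfun_eqI) (simp add: S_def blinfun.bilinear_simps)
  qed
  ultimately show ?thesis by blast
qed

lemma positive_sqrt_exists:
  assumes A: "positive_op A"
  shows "\<exists>S. positive_op S \<and> S o\<^sub>L S = A \<and> (\<forall>R. R o\<^sub>L A = A o\<^sub>L R \<longrightarrow> R o\<^sub>L S = S o\<^sub>L R)"
proof -
  define c where "c = norm A + 1"
  have c: "c > 0" by (simp add: c_def add_nonneg_pos)
  have "positive_op ((1/c) *\<^sub>R A)" using A c by (simp add: positive_op_scaleR)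
  moreover have "norm ((1/c) *\<^sub>R A) \<le> 1" using c by (simp add: c_def)
  ultimately obtain S where S: "positive_op S" "S o\<^sub>L S = (1/c) *\<^sub>R A"
    and comm: "\<And>R. R o\<^sub>L ((1/c) *\<^sub>R A) = ((1/c) *\<^sub>R A) o\<^sub>L R \<Longrightarrow> R o\<^sub>L S = S o\<^sub>L R"
    using positive_sqrt_exists_contraction by blast
  show ?thesis
  proof (intro exI[of _ "sqrt c *\<^sub>R S"] conjI allI impI)
    show "positive_op (sqrt c *\<^sub>R S)" using S c by (simp add: positive_op_scaleR)
    have "S (S x) = (1/c) *\<^sub>R A x" for x
      using S(2) by (metis blinfun_apply_blinfun_compose blinfun.scaleR_left)
    then show "(sqrt c *\<^sub>R S) o\<^sub>L (sqrt c *\<^sub>R S) = A"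
      using c by (intro blinfun_eqI) (simp add: blinfun.bilinear_simps)
    fix R assume "R o\<^sub>L A = A o\<^sub>L R"
    then have "R (A x) = A (R x)" for x by (metis blinfun_apply_blinfun_compose)
    then have "R o\<^sub>L S = S o\<^sub>L R"
      by (intro comm blinfun_eqI) (simp add: blinfun.bilinear_simps)
    then have "R (S x) = S (R x)" for x by (metis blinfun_apply_blinfun_compose)
    then show "R o\<^sub>L (sqrt c *\<^sub>R S) = (sqrt c *\<^sub>R S) o\<^sub>L R"
      by (intro blinfun_eqI) (simp add: blinfun.bilinear_simps)
  qed
qed

lemma positive_sqrt_unique:
  assumes A: "positive_op A"
  shows "\<exists>!S. positive_op S \<and> S o\<^sub>L S = A"
proof -
  obtain S where S: "positive_op S" "S o\<^sub>L S = A"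
    and comm: "\<And>R. R o\<^sub>L A = A o\<^sub>L R \<Longrightarrow> R o\<^sub>L S = S o\<^sub>L R"
    using positive_sqrt_exists[OF A] by blast
  have "R = S" if R: "positive_op R" "R o\<^sub>L R = A" for R
  proof (rule blinfun_eqI)
    fix x
    have RR: "R (R z) = A z" and SS: "S (S z) = A z" for z
      using R(2) S(2) by (metis blinfun_apply_blinfun_compose)+
    have "R o\<^sub>L A = A o\<^sub>L R" by (rule blinfun_eqI) (simp add: RR[symmetric])
    then have RS: "R (S z) = S (R z)" for z
      using comm by (metis blinfun_apply_blinfun_compose)
    \<comment> \<open>As \<open>R\<close> and \<open>S\<close> commute, \<open>(R + S) (R - S) = R\<^sup>2 - S\<^sup>2 = 0\<close>.\<close>
    define y where "y = R x - S x"
    have zero: "R y + S y = 0"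
      by (simp add: y_def blinfun.bilinear_simps RS RR SS)
    have "Re (cinner (R y) y) + Re (cinner (S y) y) = 0"
      using zero by (metis cinner_add_left cinner_zero_left plus_complex.sel(1) zero_complex.sel(1))
    then have "Re (cinner (R y) y) = 0" "Re (cinner (S y) y) = 0"
      using positive_op_ge_0[OF R(1), of y] positive_op_ge_0[OF S(1), of y] by auto
    then have "R y = 0" "S y = 0" using R(1) S(1) positive_op_zero_iff by blast+
    then have "cinner y y = 0"
      by (subst (1) y_def) (simp add: cinner_simps positive_op_sym R S)
    then show "R x = S x" by (simp add: cinner_self y_def)
  qed
  then show ?thesis using S by blast
qed

lemma norm_op_power_le: "norm (op_power X n) \<le> norm X ^ n"
proof (induction n)
  case 0
  then show ?case by (simp add: norm_blinfun_id_le)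
next
  case (Suc n)
  then show ?case
    using order_trans[OF norm_blinfun_compose mult_left_mono[OF Suc norm_ge_zero]] by simp
qed

lemma op_power_commute: "X (op_power X n x) = op_power X n (X x)"
  by (induction n) simp_all

lemma op_power_Suc_right: "op_power X (Suc n) = op_power X n o\<^sub>L X"
  by (rule blinfun_eqI) (simp add: op_power_commute)

text \<open>The inverse of \<open>1 - X\<close> is the norm-convergent series of the powers of \<open>X\<close>.\<close>

lemma neumann_inverse:
  assumes "X \<in> bounded_ops" "norm X < 1"
  shows "\<exists>Z\<in>bounded_ops. (\<forall>x. Z x - X (Z x) = x) \<and> (\<forall>x. Z (x - X x) = x)"
proof -
  have summ: "summable (op_power X)"
    by (rule summable_comparison_test'[of "\<lambda>n. norm X ^ n" 0])
       (use assms(2) in \<open>auto intro: norm_op_power_le summable_geometric\<close>)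
  define Z where "Z = suminf (op_power X)"
  have lim: "(\<lambda>n. \<Sum>k<n. op_power X k) \<longlonglongrightarrow> Z"
    using summable_LIMSEQ[OF summ] by (simp add: Z_def)
  have split: "(\<Sum>k. op_power X (Suc k)) = Z - id_blinfun"
    using suminf_split_head[OF summ] by (simp add: Z_def)
  have 1: "X o\<^sub>L Z = Z - id_blinfun"
    unfolding Z_def split[unfolded Z_def, symmetric]
    by (simp add: bounded_linear.suminf[OF bounded_bilinear.bounded_linear_right[OF bounded_bilinear_blinfun_compose] summ])
  have 2: "Z o\<^sub>L X = Z - id_blinfun"
    unfolding Z_def split[unfolded Z_def, symmetric] op_power_Suc_right
    by (simp add: bounded_linear.suminf[OF bounded_bilinear.bounded_linear_left[OF bounded_bilinear_blinfun_compose] summ])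
  have "X (Z x) = Z x - x" "Z (X x) = Z x - x" for x
    using arg_cong[OF 1, of "\<lambda>T. blinfun_apply T x"] arg_cong[OF 2, of "\<lambda>T. blinfun_apply T x"]
    by (simp_all add: blinfun.bilinear_simps)
  moreover have "Z \<in> bounded_ops"
    by (rule bounded_ops_limit[OF _ lim]) (intro bounded_ops_sum bounded_ops_op_power assms)
  ultimately show ?thesis by (intro bexI[of _ Z]) (auto simp: blinfun.bilinear_simps)
qed

lemma positive_resolvent_exists:
  assumes P: "positive_op P" and "\<epsilon> > 0"
  shows "\<exists>R\<in>bounded_ops. (\<forall>x. P (R x) + \<epsilon> *\<^sub>R R x = x) \<and> (\<forall>x. R (P x + \<epsilon> *\<^sub>R x) = x)"
proof -
  \<comment> \<open>With this \<open>c\<close>, \<open>X = 1 - (P + \<epsilon>) / c\<close> is positive and at most \<open>1 - \<epsilon> / c\<close>.\<close>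
  define c where "c = norm P + \<epsilon>"
  have c: "c > 0" "\<epsilon> \<le> c" using \<open>\<epsilon> > 0\<close> by (simp_all add: c_def add_nonneg_pos)
  define X where "X = id_blinfun - (1/c) *\<^sub>R (P + \<epsilon> *\<^sub>R id_blinfun)"
  have X: "X x = x - (1/c) *\<^sub>R (P x + \<epsilon> *\<^sub>R x)" for x
    by (simp add: X_def blinfun.bilinear_simps)
  have Xb: "X \<in> bounded_ops"
    using P unfolding X_def positive_op_def
    by (intro bounded_ops_diff bounded_ops_scaleR bounded_ops_add bounded_ops_id) auto
  have XR: "Re (cinner (X x) x) = (1 - \<epsilon>/c) * (norm x)\<^sup>2 - Re (cinner (P x) x) / c" for x
    by (simp add: X cinner_simps cinner_self field_simps)
  have "positive_op X"
  proof (intro positive_opI Xb)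
    show "cinner (X x) y = cinner x (X y)" for x y
      by (simp add: X cinner_simps positive_op_sym[OF P])
    show "0 \<le> Re (cinner (X x) x)" for x
    proof -
      have "1 - \<epsilon>/c = norm P / c" using c by (simp add: c_def field_simps)
      then show ?thesis
        using Re_cinner_le_norm[of P x] c by (simp add: XR divide_right_mono)
    qed
  qed
  then have "norm X \<le> 1 - \<epsilon>/c"
    using c positive_op_ge_0[OF P] by (intro positive_op_norm_le) (simp_all add: XR)
  then have "norm X < 1" using c \<open>\<epsilon> > 0\<close> by (smt (verit) divide_pos_pos)
  then obtain Z where Z: "Z \<in> bounded_ops" "\<And>x. Z x - X (Z x) = x" "\<And>x. Z (x - X x) = x"
    using neumann_inverse[OF Xb] by blast
  show ?thesis
  proof (intro bexI[of _ "(1/c) *\<^sub>R Z"] conjI allI)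
    fix x
    show "P (((1/c) *\<^sub>R Z) x) + \<epsilon> *\<^sub>R ((1/c) *\<^sub>R Z) x = x"
      using Z(2)[of x] by (simp add: X blinfun.bilinear_simps scaleR_add_right add.commute)
    show "((1/c) *\<^sub>R Z) (P x + \<epsilon> *\<^sub>R x) = x"
      using Z(3)[of x] by (simp add: X blinfun.bilinear_simps scaleR_add_right add.commute)
  qed (simp add: Z bounded_ops_scaleR)
qed

context hilbert_basis begin

section \<open>The absolute value of an operator\<close>

lemma abs_op:
  fixes T :: "'h \<Rightarrow>\<^sub>L 'h"
  assumes T: "T \<in> bounded_ops"
  shows positive_abs_op: "positive_op (abs_op T)"
    and abs_op_cinner: "cinner (abs_op T x) (abs_op T y) = cinner (T x) (T y)"
proof -
  have sym: "cinner (adjoint_op T (T x)) y = cinner (T x) (T y)" for x y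
    by (metis T adjoint_op_cinner cinner_commute)
  have "positive_op (adjoint_op T o\<^sub>L T)"
    by (intro positive_opI bounded_ops_compose T adjoint_op_bounded_ops)
       (simp_all add: sym adjoint_op_cinner[OF T, symmetric] cinner_self)
  from theI'[OF positive_sqrt_unique[OF this]]
  have *: "positive_op (abs_op T) \<and> abs_op T o\<^sub>L abs_op T = adjoint_op T o\<^sub>L T"
    unfolding abs_op_def .
  then show "positive_op (abs_op T)" by blast
  have "cinner (abs_op T x) (abs_op T y) = cinner ((abs_op T o\<^sub>L abs_op T) x) y"
    using positive_op_sym[of "abs_op T" "abs_op T x" y] * by (metis blinfun_apply_blinfun_compose)
  then show "cinner (abs_op T x) (abs_op T y) = cinner (T x) (T y)"
    using * sym by simp
qed

lemma norm_abs_op: "(T :: 'h \<Rightarrow>\<^sub>L 'h) \<in> bounded_ops \<Longrightarrow> norm (abs_op T x) = norm (T x)"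
  by (simp add: norm_eq_sqrt_cinner abs_op_cinner)

text \<open>
  A contraction \<open>U\<close> that approximates the partial isometry of the polar decomposition:
  \<open>U = T \<circ> (|T| + \<epsilon>)\<^sup>-\<^sup>1\<close>.
\<close>

lemma approximate_polar_decomposition:
  fixes T :: "'h \<Rightarrow>\<^sub>L 'h"
  assumes T: "T \<in> bounded_ops" and "\<epsilon> > 0"
  obtains U where "U \<in> bounded_ops" "\<And>x. norm (U x) \<le> norm x"
    "\<And>x. T x = U (abs_op T x) + \<epsilon> *\<^sub>R U x"
    "\<And>x. Re (cinner (abs_op T x) x) \<le> Re (cinner (T x) (U x)) + \<epsilon> * (norm x)\<^sup>2"
proof -
  let ?P = "abs_op T"
  note P = positive_abs_op[OF T]
  obtain R where R: "R \<in> bounded_ops" "\<And>x. ?P (R x) + \<epsilon> *\<^sub>R R x = x"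
    "\<And>x. R (?P x + \<epsilon> *\<^sub>R x) = x"
    using positive_resolvent_exists[OF P \<open>\<epsilon> > 0\<close>] by blast
  have PR: "norm (?P (R x)) \<le> norm x" for x
  proof (rule power2_le_imp_le)
    have "(norm x)\<^sup>2 = (norm (?P (R x) + \<epsilon> *\<^sub>R R x))\<^sup>2"
      by (simp only: R(2))
    also have "\<dots> = (norm (?P (R x)))\<^sup>2 + 2 * \<epsilon> * Re (cinner (?P (R x)) (R x)) + \<epsilon>\<^sup>2 * (norm (R x))\<^sup>2"
      by (simp add: norm_add_power2 cinner_scaleR_right power_mult_distrib)
    finally have "(norm x)\<^sup>2 = \<dots>" .
    moreover have "0 \<le> 2 * \<epsilon> * Re (cinner (?P (R x)) (R x))" "0 \<le> \<epsilon>\<^sup>2 * (norm (R x))\<^sup>2"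
      using \<open>\<epsilon> > 0\<close> positive_op_ge_0[OF P] by simp_all
    ultimately show "(norm (?P (R x)))\<^sup>2 \<le> (norm x)\<^sup>2" by linarith
  qed simp
  show ?thesis
  proof (rule that[of "T o\<^sub>L R"])
    show "T o\<^sub>L R \<in> bounded_ops" by (simp add: T R bounded_ops_compose)
    show "norm ((T o\<^sub>L R) x) \<le> norm x" for x using PR norm_abs_op[OF T] by simp
    show "T x = (T o\<^sub>L R) (?P x) + \<epsilon> *\<^sub>R (T o\<^sub>L R) x" for x
      using arg_cong[OF R(3)[of x], of "blinfun_apply T"] by (simp add: blinfun.bilinear_simps)
    fix x
    have eq: "?P (R x) = x - \<epsilon> *\<^sub>R R x" using R(2)[of x] by (simp add: algebra_simps)
    have "cinner (T x) (T (R x)) = cinner (?P x) (x - \<epsilon> *\<^sub>R R x)"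
      by (simp add: abs_op_cinner[OF T, symmetric] eq)
    then have "Re (cinner (T x) (T (R x))) = Re (cinner (?P x) x) - \<epsilon> * Re (cinner x (?P (R x)))"
      by (simp add: cinner_simps positive_op_sym[OF P])
    moreover have "Re (cinner x (?P (R x))) \<le> (norm x)\<^sup>2"
      using Re_cinner_le[of x "?P (R x)"] mult_left_mono[OF PR[of x], of "norm x"]
      by (simp add: power2_eq_square)
    ultimately show "Re (cinner (?P x) x) \<le> Re (cinner (T x) ((T o\<^sub>L R) x)) + \<epsilon> * (norm x)\<^sup>2"
      using \<open>\<epsilon> > 0\<close> by simp
  qed
qed

end

section \<open>The criterion on a normed left ideal of operators\<close>

lemma d_hypercyclicity_criterionE:
  assumes "d_hypercyclicity_criterion A \<nu> N T"
  obtains n X V where "strict_mono n" "\<forall>k. n k \<ge> (1 :: nat)"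
    "\<And>l. l \<in> {0..N} \<Longrightarrow> dense_wrt A \<nu> (X l)"
    "\<And>l k. l \<in> {1..N} \<Longrightarrow> V l k ` X l \<subseteq> A"
    "\<And>l x. l \<in> {1..N} \<Longrightarrow> x \<in> X 0 \<Longrightarrow> tendsto_wrt \<nu> (\<lambda>k. (T l ^^ n k) x) 0"
    "\<And>l x. l \<in> {1..N} \<Longrightarrow> x \<in> X l \<Longrightarrow> tendsto_wrt \<nu> (\<lambda>k. V l k x) 0"
    "\<And>l s x. l \<in> {1..N} \<Longrightarrow> s \<in> {1..N} \<Longrightarrow> s \<noteq> l \<Longrightarrow> x \<in> X s \<Longrightarrow>
      tendsto_wrt \<nu> (\<lambda>k. (T l ^^ n k) (V s k x)) 0"
    "\<And>l x. l \<in> {1..N} \<Longrightarrow> x \<in> X l \<Longrightarrow> tendsto_wrt \<nu> (\<lambda>k. (T l ^^ n k) (V l k x)) x"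
  using assms unfolding d_hypercyclicity_criterion_def
  apply (elim exE conjE)
  subgoal for n X V by (rule that[of n X V]) simp_all
  done

text \<open>
  The properties shared by the three operator spaces that the transfer of the criterion needs.
  \<open>finite_cols\<close> bounds the norm of an operator that vanishes on almost all basis vectors by its
  columns, \<open>col_le\<close> bounds a column by the norm, and \<open>proj_approx\<close> says that truncation
  approximates in the norm.
\<close>

locale normed_left_ideal = hilbert_basis e for e :: "nat \<Rightarrow> 'h::complex_hilbert" +
  fixes \<B> :: "('h \<Rightarrow>\<^sub>L 'h) set" and \<nu> :: "('h \<Rightarrow>\<^sub>L 'h) \<Rightarrow> real"
  assumes ideal_bounded: "F \<in> \<B> \<Longrightarrow> F \<in> bounded_ops"
    and finite_cols_mem: "F \<in> bounded_ops \<Longrightarrow> (\<And>j. j \<ge> m \<Longrightarrow> F (e j) = 0) \<Longrightarrow> F \<in> \<B>"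
    and finite_cols_le:
      "F \<in> bounded_ops \<Longrightarrow> (\<And>j. j \<ge> m \<Longrightarrow> F (e j) = 0) \<Longrightarrow> \<nu> F \<le> (\<Sum>j<m. norm (F (e j)))"
    and add_mem: "F \<in> \<B> \<Longrightarrow> G \<in> \<B> \<Longrightarrow> F + G \<in> \<B>"
    and add_le: "F \<in> \<B> \<Longrightarrow> G \<in> \<B> \<Longrightarrow> \<nu> (F + G) \<le> \<nu> F + \<nu> G"
    and compose_mem: "T \<in> bounded_ops \<Longrightarrow> F \<in> \<B> \<Longrightarrow> T o\<^sub>L F \<in> \<B>"
    and col_le: "F \<in> \<B> \<Longrightarrow> norm (F (e 0)) \<le> \<nu> F"
    and proj_approx: "F \<in> \<B> \<Longrightarrow> \<epsilon> > 0 \<Longrightarrow> \<exists>m. \<nu> (F - (F o\<^sub>L proj m)) < \<epsilon>"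
begin

lemma zero_mem: "0 \<in> \<B>"
  by (rule finite_cols_mem[of _ 0]) (simp_all add: bounded_ops_0)

lemma diff_mem: assumes "F \<in> \<B>" "G \<in> \<B>" shows "F - G \<in> \<B>"
proof -
  have "((-1) *\<^sub>R id_blinfun) o\<^sub>L G \<in> \<B>"
    by (intro compose_mem bounded_ops_scaleR bounded_ops_id assms)
  also have "((-1) *\<^sub>R id_blinfun) o\<^sub>L G = - G"
    by (rule blinfun_eqI) (simp add: blinfun.bilinear_simps)
  finally show ?thesis using add_mem[OF assms(1)] by (metis diff_conv_add_uminus)
qed

lemma left_multiplier_pow_apply: "(left_multiplier T ^^ k) F x = (blinfun_apply T ^^ k) (F x)"
  by (induction k) (simp_all add: left_multiplier_def)

lemma left_multiplier_pow_mem: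
  "T \<in> bounded_ops \<Longrightarrow> F \<in> \<B> \<Longrightarrow> (left_multiplier T ^^ k) F \<in> \<B>"
  by (induction k) (simp_all add: left_multiplier_def compose_mem)

lemma left_multiplier_pow_bounded_ops:
  "T \<in> bounded_ops \<Longrightarrow> F \<in> bounded_ops \<Longrightarrow> (left_multiplier T ^^ k) F \<in> bounded_ops"
  by (induction k) (simp_all add: left_multiplier_def bounded_ops_compose)

lemma tendsto_wrt_norm_iff: "tendsto_wrt norm f x \<longleftrightarrow> f \<longlonglongrightarrow> (x :: 'h)"
  unfolding tendsto_wrt_def by (simp add: tendsto_norm_zero_iff LIM_zero_iff)

lemma tendsto_col:
  assumes "tendsto_wrt \<nu> f F" "\<And>k. f k \<in> \<B>" "F \<in> \<B>"
  shows "tendsto_wrt norm (\<lambda>k. f k (e 0)) (F (e 0))"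
  unfolding tendsto_wrt_def
proof (rule tendsto_sandwich[OF always_eventually always_eventually tendsto_const])
  show "(\<lambda>k. \<nu> (f k - F)) \<longlonglongrightarrow> 0" using assms(1) by (simp add: tendsto_wrt_def)
  show "\<forall>k. norm (f k (e 0) - F (e 0)) \<le> \<nu> (f k - F)"
    using col_le[OF diff_mem[OF assms(2,3)]] by (simp add: blinfun.diff_left)
qed simp

lemma tendsto_finite_cols:
  assumes "\<And>k. f k \<in> bounded_ops" "F \<in> bounded_ops"
    and "\<And>k j. j \<ge> m \<Longrightarrow> f k (e j) = 0" "\<And>j. j \<ge> m \<Longrightarrow> F (e j) = 0"
    and "\<And>j. j < m \<Longrightarrow> (\<lambda>k. f k (e j)) \<longlonglongrightarrow> F (e j)"
  shows "tendsto_wrt \<nu> f F"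
  unfolding tendsto_wrt_def
proof (rule tendsto_sandwich[OF always_eventually always_eventually tendsto_const])
  have cols: "f k - F \<in> bounded_ops" "j \<ge> m \<Longrightarrow> (f k - F) (e j) = 0" for k j
    using assms by (simp_all add: bounded_ops_diff blinfun.diff_left)
  show "\<forall>k. \<nu> (f k - F) \<le> (\<Sum>j<m. norm ((f k - F) (e j)))"
    using finite_cols_le[OF cols] by blast
  show "\<forall>k. 0 \<le> \<nu> (f k - F)"
    using col_le[OF finite_cols_mem[OF cols]] by (meson norm_ge_zero order_trans)
  have "(\<lambda>k. \<Sum>j<m. norm ((f k - F) (e j))) \<longlonglongrightarrow> (\<Sum>j<m. 0)"
    unfolding blinfun.diff_left
    by (intro tendsto_sum tendsto_norm_zero) (use assms(5) LIM_zero in auto)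
  then show "(\<lambda>k. \<Sum>j<m. norm ((f k - F) (e j))) \<longlonglongrightarrow> 0" by simp
qed

text \<open>
  Evaluation at \<open>e 0\<close> is a contractive surjection that intertwines \<open>L\<^sub>T\<close> and \<open>T\<close>. The maps of
  the criterion need not be linear or continuous, so preimages may be chosen arbitrarily.
\<close>

lemma criterion_from_multipliers:
  assumes T: "\<And>l. l \<in> {1..N} \<Longrightarrow> T l \<in> bounded_ops"
    and "d_hypercyclicity_criterion \<B> \<nu> N (\<lambda>l. left_multiplier (T l))"
  shows "d_hypercyclicity_criterion (UNIV :: 'h set) norm N (\<lambda>l. blinfun_apply (T l))"
proof -
  let ?L = "\<lambda>l. left_multiplier (T l)"
  obtain n X V where n: "strict_mono n" "\<forall>k. n k \<ge> (1 :: nat)"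
    and dense: "\<And>l. l \<in> {0..N} \<Longrightarrow> dense_wrt \<B> \<nu> (X l)"
    and V: "\<And>l k. l \<in> {1..N} \<Longrightarrow> V l k ` X l \<subseteq> \<B>"
    and c0: "\<And>l F. l \<in> {1..N} \<Longrightarrow> F \<in> X 0 \<Longrightarrow> tendsto_wrt \<nu> (\<lambda>k. (?L l ^^ n k) F) 0"
    and c1: "\<And>l F. l \<in> {1..N} \<Longrightarrow> F \<in> X l \<Longrightarrow> tendsto_wrt \<nu> (\<lambda>k. V l k F) 0"
    and c2: "\<And>l s F. l \<in> {1..N} \<Longrightarrow> s \<in> {1..N} \<Longrightarrow> s \<noteq> l \<Longrightarrow> F \<in> X s \<Longrightarrow>
        tendsto_wrt \<nu> (\<lambda>k. (?L l ^^ n k) (V s k F)) 0"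
    and c3: "\<And>l F. l \<in> {1..N} \<Longrightarrow> F \<in> X l \<Longrightarrow> tendsto_wrt \<nu> (\<lambda>k. (?L l ^^ n k) (V l k F)) F"
    using assms(2) by (rule d_hypercyclicity_criterionE) blast
  have X: "F \<in> \<B>" if "l \<in> {0..N}" "F \<in> X l" for l F
    using dense[OF that(1)] that(2) by (auto simp: dense_wrt_def)
  have V': "V l k F \<in> \<B>" if "l \<in> {1..N}" "F \<in> X l" for l k F
    using V[OF that(1)] that(2) by blast
  define Y where "Y l = (\<lambda>F :: 'h \<Rightarrow>\<^sub>L 'h. F (e 0)) ` X l" for l
  define sel where "sel l y = (SOME F. F \<in> X l \<and> blinfun_apply F (e 0) = y)" for l y
  have sel: "sel l y \<in> X l" "sel l y (e 0) = y" if "y \<in> Y l" for l y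
    using someI_ex[of "\<lambda>F. F \<in> X l \<and> blinfun_apply F (e 0) = y"] that
    unfolding sel_def Y_def by blast+
  define U where "U l k y = V l k (sel l y) (e 0)" for l k y
  have pow: "(blinfun_apply (T l) ^^ k) (F (e 0)) = (?L l ^^ k) F (e 0)" for l k and F :: "'h \<Rightarrow>\<^sub>L 'h"
    by (simp add: left_multiplier_pow_apply)
  have "dense_wrt UNIV norm (Y l)" if l: "l \<in> {0..N}" for l
    unfolding dense_wrt_def
  proof (intro conjI ballI allI impI)
    fix y :: 'h and \<epsilon> :: real assume "\<epsilon> > 0"
    let ?F = "cols 1 (\<lambda>_. y)"
    have F: "?F \<in> \<B>" by (rule finite_cols_mem[of _ 1]) (auto simp: cols_bounded_ops cols_basis)
    then obtain G where G: "G \<in> X l" "\<nu> (?F - G) < \<epsilon>"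
      using dense[OF l] \<open>\<epsilon> > 0\<close> unfolding dense_wrt_def by blast
    have "norm (y - G (e 0)) \<le> \<nu> (?F - G)"
      using col_le[OF diff_mem[OF F X[OF l G(1)]]] by (simp add: blinfun.diff_left cols_basis)
    then show "\<exists>z\<in>Y l. norm (y - z) < \<epsilon>" using G by (force simp: Y_def)
  qed simp
  moreover have "tendsto_wrt norm (\<lambda>k. (blinfun_apply (T l) ^^ n k) y) 0"
    if l: "l \<in> {1..N}" and y: "y \<in> Y 0" for l y
  proof -
    obtain F where F: "F \<in> X 0" "y = F (e 0)" using y by (auto simp: Y_def)
    show ?thesis
      using tendsto_col[OF c0[OF l F(1)] left_multiplier_pow_mem[OF T[OF l] X[of 0, OF _ F(1)]] zero_mem]
      by (simp add: F(2) pow)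
  qed
  moreover have "tendsto_wrt norm (\<lambda>k. U l k y) 0" if "l \<in> {1..N}" "y \<in> Y l" for l y
    using tendsto_col[OF c1[OF that(1) sel(1)[OF that(2)]] V'[OF that(1) sel(1)[OF that(2)]] zero_mem]
    by (simp add: U_def)
  moreover have "tendsto_wrt norm (\<lambda>k. (blinfun_apply (T l) ^^ n k) (U s k y)) 0"
    if "l \<in> {1..N}" "s \<in> {1..N}" "s \<noteq> l" "y \<in> Y s" for l s y
    using tendsto_col[OF c2[OF that(1-3) sel(1)[OF that(4)]]
      left_multiplier_pow_mem[OF T[OF that(1)] V'[OF that(2) sel(1)[OF that(4)]]] zero_mem]
    by (simp add: U_def pow)
  moreover have "tendsto_wrt norm (\<lambda>k. (blinfun_apply (T l) ^^ n k) (U l k y)) y"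
    if "l \<in> {1..N}" "y \<in> Y l" for l y
    using tendsto_col[OF c3[OF that(1) sel(1)[OF that(2)]]
      left_multiplier_pow_mem[OF T[OF that(1)] V'[OF that(1) sel(1)[OF that(2)]]]
      X[OF _ sel(1)[OF that(2)]]] that
    by (simp add: U_def pow sel(2))
  ultimately show ?thesis
    unfolding d_hypercyclicity_criterion_def
    by (intro exI[of _ n] exI[of _ Y] exI[of _ U] conjI n) auto
qed

text \<open>
  Conversely, the maps \<open>V\<close> act column by column on the operators with finitely many nonzero
  columns, all of them in the given dense set. The value \<open>0\<close> is adjoined to the dense sets
  (with \<open>V 0 = 0\<close>) because the other columns vanish.
\<close>

lemma criterion_to_multipliers:
  assumes T: "\<And>l. l \<in> {1..N} \<Longrightarrow> T l \<in> bounded_ops"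
    and "d_hypercyclicity_criterion (UNIV :: 'h set) norm N (\<lambda>l. blinfun_apply (T l))"
  shows "d_hypercyclicity_criterion \<B> \<nu> N (\<lambda>l. left_multiplier (T l))"
proof -
  let ?T = "\<lambda>l. blinfun_apply (T l)" and ?L = "\<lambda>l. left_multiplier (T l)"
  obtain n X V where n: "strict_mono n" "\<forall>k. n k \<ge> (1 :: nat)"
    and dense: "\<And>l. l \<in> {0..N} \<Longrightarrow> dense_wrt (UNIV :: 'h set) norm (X l)"
    and c0: "\<And>l x. l \<in> {1..N} \<Longrightarrow> x \<in> X 0 \<Longrightarrow> (\<lambda>k. (?T l ^^ n k) x) \<longlonglongrightarrow> 0"
    and c1: "\<And>l x. l \<in> {1..N} \<Longrightarrow> x \<in> X l \<Longrightarrow> (\<lambda>k. V l k x) \<longlonglongrightarrow> 0"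
    and c2: "\<And>l s x. l \<in> {1..N} \<Longrightarrow> s \<in> {1..N} \<Longrightarrow> s \<noteq> l \<Longrightarrow> x \<in> X s \<Longrightarrow>
        (\<lambda>k. (?T l ^^ n k) (V s k x)) \<longlonglongrightarrow> 0"
    and c3: "\<And>l x. l \<in> {1..N} \<Longrightarrow> x \<in> X l \<Longrightarrow> (\<lambda>k. (?T l ^^ n k) (V l k x)) \<longlonglongrightarrow> x"
    using assms(2) unfolding tendsto_wrt_norm_iff[symmetric]
    by (rule d_hypercyclicity_criterionE) blast
  have pow0: "(?T l ^^ k) 0 = 0" for l k by (induction k) simp_all
  define V0 where "V0 l k x = (if x = 0 then 0 else V l k x)" for l k x
  define Y where "Y l = {F \<in> bounded_ops.
      (\<forall>j. blinfun_apply F (e j) \<in> insert 0 (X l)) \<and> (\<exists>m. \<forall>j\<ge>m. F (e j) = 0)}" for l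
  define len where "len F = (SOME m. \<forall>j\<ge>m. blinfun_apply F (e j) = 0)" for F :: "'h \<Rightarrow>\<^sub>L 'h"
  have len: "j \<ge> len F \<Longrightarrow> F (e j) = 0" if "F \<in> Y l" for F l j
    using someI_ex[of "\<lambda>m. \<forall>j\<ge>m. blinfun_apply F (e j) = 0"] that unfolding len_def Y_def by blast
  define U where "U l k F = cols (len F) (\<lambda>j. V0 l k (F (e j)))" for l k F
  have Y: "F \<in> bounded_ops" "F (e j) \<in> insert 0 (X l)" if "F \<in> Y l" for F j l
    using that by (auto simp: Y_def)
  have U_b: "U l k F \<in> bounded_ops" for l k F by (simp add: U_def cols_bounded_ops)
  have U_col: "U l k F (e j) = V0 l k (F (e j))" if "F \<in> Y l" for l k F j
    using len[OF that, of j] by (simp add: U_def cols_basis V0_def)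
  have Y_mem: "F \<in> \<B>" if "F \<in> Y l" for F l
    using finite_cols_mem[OF Y(1)[OF that] len[OF that]] .
  have U_mem: "U l k F \<in> \<B>" for l k F
    by (rule finite_cols_mem[OF U_b, of "len F"]) (simp add: U_def cols_basis)
  have "dense_wrt \<B> \<nu> (Y l)" if l: "l \<in> {0..N}" for l
    unfolding dense_wrt_def
  proof (intro conjI ballI allI impI)
    show "Y l \<subseteq> \<B>" using Y_mem by blast
    fix F \<epsilon> assume F: "F \<in> \<B>" and \<epsilon>: "\<epsilon> > (0 :: real)"
    obtain m where m: "\<nu> (F - (F o\<^sub>L proj m)) < \<epsilon> / 2" using proj_approx[OF F, of "\<epsilon> / 2"] \<epsilon> by auto
    define \<delta> where "\<delta> = \<epsilon> / 2 / (real m + 1)"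
    have \<delta>: "\<delta> > 0" "real m * \<delta> \<le> \<epsilon> / 2" using \<epsilon> by (simp_all add: \<delta>_def field_simps)
    have "\<forall>j. \<exists>y\<in>X l. norm (F (e j) - y) < \<delta>"
      using dense[OF l] \<delta>(1) unfolding dense_wrt_def by blast
    then obtain y where y: "\<And>j. y j \<in> X l" "\<And>j. norm (F (e j) - y j) < \<delta>" by metis
    define G where "G = cols m y"
    have "G \<in> Y l"
      using y(1) by (auto simp: Y_def G_def cols_bounded_ops cols_basis intro!: exI[of _ m])
    define H where "H = (F o\<^sub>L proj m) - G"
    have Hb: "H \<in> bounded_ops"
      unfolding H_def G_def
      by (intro bounded_ops_diff bounded_ops_compose ideal_bounded[OF F] proj_bounded_ops cols_bounded_ops)
    have H_col: "H (e j) = (if j < m then F (e j) - y j else 0)" for j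
      by (simp add: H_def G_def blinfun.diff_left proj_basis cols_basis)
    have H_mem: "H \<in> \<B>" by (rule finite_cols_mem[OF Hb, of m]) (simp add: H_col)
    have "\<nu> H \<le> (\<Sum>j<m. norm (H (e j)))" by (rule finite_cols_le[OF Hb]) (simp add: H_col)
    also have "\<dots> \<le> (\<Sum>j<m. \<delta>)"
      using y(2) by (intro sum_mono) (simp add: H_col less_imp_le)
    also have "\<dots> \<le> \<epsilon> / 2" using \<delta>(2) by simp
    finally have "\<nu> H \<le> \<epsilon> / 2" .
    have FP: "F o\<^sub>L proj m \<in> \<B>"
      by (rule finite_cols_mem[of _ m])
         (simp_all add: bounded_ops_compose ideal_bounded[OF F] proj_bounded_ops proj_basis)
    have "\<nu> (F - G) \<le> \<nu> (F - (F o\<^sub>L proj m)) + \<nu> H"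
      using add_le[OF diff_mem[OF F FP] H_mem] by (simp add: H_def)
    then have "\<nu> (F - G) < \<epsilon>" using m \<open>\<nu> H \<le> \<epsilon> / 2\<close> by linarith
    then show "\<exists>G\<in>Y l. \<nu> (F - G) < \<epsilon>" using \<open>G \<in> Y l\<close> by blast
  qed
  moreover have "tendsto_wrt \<nu> (\<lambda>k. (?L l ^^ n k) F) 0" if "l \<in> {1..N}" "F \<in> Y 0" for l F
  proof (rule tendsto_finite_cols[where m = "len F"])
    show "(\<lambda>k. (?L l ^^ n k) F (e j)) \<longlonglongrightarrow> blinfun_apply 0 (e j)" for j
      using Y(2)[OF that(2), of j] c0[OF that(1)]
      by (auto simp: left_multiplier_pow_apply pow0)
  qed (use T that Y len[OF that(2)] in
      \<open>simp_all add: left_multiplier_pow_bounded_ops left_multiplier_pow_apply pow0 bounded_ops_0\<close>)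
  moreover have "tendsto_wrt \<nu> (\<lambda>k. U l k F) 0" if "l \<in> {1..N}" "F \<in> Y l" for l F
  proof (rule tendsto_finite_cols[where m = "len F"])
    show "(\<lambda>k. U l k F (e j)) \<longlonglongrightarrow> blinfun_apply 0 (e j)" for j
      using Y(2)[OF that(2), of j] c1[OF that(1)]
      by (cases "F (e j) = 0") (auto simp: U_col[OF that(2)] V0_def)
  qed (use len[OF that(2)] in \<open>simp_all add: U_b U_col[OF that(2)] V0_def bounded_ops_0\<close>)
  moreover have "tendsto_wrt \<nu> (\<lambda>k. (?L l ^^ n k) (U s k F)) 0"
    if "l \<in> {1..N}" "s \<in> {1..N}" "s \<noteq> l" "F \<in> Y s" for l s F
  proof (rule tendsto_finite_cols[where m = "len F"])
    show "(\<lambda>k. (?L l ^^ n k) (U s k F) (e j)) \<longlonglongrightarrow> blinfun_apply 0 (e j)" for j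
      using Y(2)[OF that(4), of j] c2[OF that(1-3)]
      by (cases "F (e j) = 0") (auto simp: left_multiplier_pow_apply U_col[OF that(4)] V0_def pow0)
  qed (use T that len[OF that(4)] in \<open>simp_all add: left_multiplier_pow_bounded_ops
      left_multiplier_pow_apply U_b U_col[OF that(4)] V0_def pow0 bounded_ops_0\<close>)
  moreover have "tendsto_wrt \<nu> (\<lambda>k. (?L l ^^ n k) (U l k F)) F"
    if "l \<in> {1..N}" "F \<in> Y l" for l F
  proof (rule tendsto_finite_cols[where m = "len F"])
    show "(\<lambda>k. (?L l ^^ n k) (U l k F) (e j)) \<longlonglongrightarrow> F (e j)" for j
      using Y(2)[OF that(2), of j] c3[OF that(1)]
      by (cases "F (e j) = 0") (auto simp: left_multiplier_pow_apply U_col[OF that(2)] V0_def pow0)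
  qed (use T that Y len[OF that(2)] in \<open>simp_all add: left_multiplier_pow_bounded_ops
      left_multiplier_pow_apply U_b U_col[OF that(2)] V0_def pow0\<close>)
  ultimately show ?thesis
    unfolding d_hypercyclicity_criterion_def using U_mem
    by (intro exI[of _ n] exI[of _ Y] exI[of _ U] conjI n) auto
qed

end

context hilbert_basis begin

section \<open>Hilbert--Schmidt operators\<close>

lemma hilbert_schmidt_partial_le:
  assumes "F \<in> hilbert_schmidt_ops e"
  shows "L2_set (\<lambda>j. norm (F (e j))) {..<n} \<le> hilbert_schmidt_norm e F"
  unfolding L2_set_def hilbert_schmidt_norm_def
  using assms by (auto simp: hilbert_schmidt_ops_def intro!: sum_le_suminf)

lemma hilbert_schmidt_boundI:
  assumes F: "F \<in> bounded_ops" and le: "\<And>n. L2_set (\<lambda>j. norm (blinfun_apply F (e j))) {..<n} \<le> K"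
  shows "F \<in> hilbert_schmidt_ops e" "hilbert_schmidt_norm e F \<le> K"
proof -
  have K: "K \<ge> 0" using le[of 0] by simp
  have sums: "(\<Sum>j<n. (norm (F (e j)))\<^sup>2) \<le> K\<^sup>2" for n
    using le[of n] K by (simp add: L2_set_def real_sqrt_le_iff' sum_nonneg)
  have summ: "summable (\<lambda>j. (norm (F (e j)))\<^sup>2)"
    by (rule bounded_imp_summable[where B = "K\<^sup>2"]) (simp_all only: lessThan_Suc_atMost[symmetric] sums, simp)
  then show "F \<in> hilbert_schmidt_ops e" using F by (simp add: hilbert_schmidt_ops_def)
  have "(\<Sum>j. (norm (F (e j)))\<^sup>2) \<le> K\<^sup>2" by (rule suminf_le_const[OF summ sums])
  then show "hilbert_schmidt_norm e F \<le> K"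
    unfolding hilbert_schmidt_norm_def using K by (simp add: real_le_lsqrt)
qed

lemma hilbert_schmidt_ideal:
  "normed_left_ideal e (hilbert_schmidt_ops e) (hilbert_schmidt_norm e)"
proof unfold_locales
  show bdd: "F \<in> bounded_ops" if "F \<in> hilbert_schmidt_ops e" for F
    using that by (simp add: hilbert_schmidt_ops_def)
  show "F \<in> hilbert_schmidt_ops e" "hilbert_schmidt_norm e F \<le> (\<Sum>j<m. norm (F (e j)))"
    if F: "F \<in> bounded_ops" and 0: "\<And>j. j \<ge> m \<Longrightarrow> F (e j) = 0" for F m
  proof -
    have "L2_set (\<lambda>j. norm (F (e j))) {..<n} \<le> (\<Sum>j<m. norm (F (e j)))" for n
    proof -
      have "L2_set (\<lambda>j. norm (F (e j))) {..<n} \<le> (\<Sum>j<n. norm (F (e j)))"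
        by (rule L2_set_le_sum) simp
      also have "\<dots> \<le> (\<Sum>j<m. norm (F (e j)))" by (rule sum_norm_cols_le[OF 0])
      finally show ?thesis .
    qed
    from hilbert_schmidt_boundI[OF F this]
    show "F \<in> hilbert_schmidt_ops e" "hilbert_schmidt_norm e F \<le> (\<Sum>j<m. norm (F (e j)))" .
  qed
  show "F + G \<in> hilbert_schmidt_ops e"
    "hilbert_schmidt_norm e (F + G) \<le> hilbert_schmidt_norm e F + hilbert_schmidt_norm e G"
    if FG: "F \<in> hilbert_schmidt_ops e" "G \<in> hilbert_schmidt_ops e" for F G
  proof -
    have "L2_set (\<lambda>j. norm ((F + G) (e j))) {..<n} \<le> hilbert_schmidt_norm e F + hilbert_schmidt_norm e G" for n
    proof -
      have "L2_set (\<lambda>j. norm ((F + G) (e j))) {..<n} \<le> L2_set (\<lambda>j. norm (F (e j)) + norm (G (e j))) {..<n}"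
        by (intro L2_set_mono) (simp_all add: blinfun.add_left norm_triangle_ineq)
      also have "\<dots> \<le> L2_set (\<lambda>j. norm (F (e j))) {..<n} + L2_set (\<lambda>j. norm (G (e j))) {..<n}"
        by (rule L2_set_triangle_ineq)
      finally show ?thesis
        using hilbert_schmidt_partial_le[OF FG(1), of n] hilbert_schmidt_partial_le[OF FG(2), of n]
        by linarith
    qed
    from hilbert_schmidt_boundI[OF bounded_ops_add[OF bdd[OF FG(1)] bdd[OF FG(2)]] this]
    show "F + G \<in> hilbert_schmidt_ops e"
      "hilbert_schmidt_norm e (F + G) \<le> hilbert_schmidt_norm e F + hilbert_schmidt_norm e G" .
  qed
  show "T o\<^sub>L F \<in> hilbert_schmidt_ops e" if T: "T \<in> bounded_ops" and F: "F \<in> hilbert_schmidt_ops e" for T F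
  proof (rule hilbert_schmidt_boundI)
    show "T o\<^sub>L F \<in> bounded_ops" by (intro bounded_ops_compose T bdd F)
    fix n
    have "L2_set (\<lambda>j. norm ((T o\<^sub>L F) (e j))) {..<n} \<le> L2_set (\<lambda>j. norm T * norm (F (e j))) {..<n}"
      by (intro L2_set_mono) (simp_all add: norm_blinfun)
    also have "\<dots> = norm T * L2_set (\<lambda>j. norm (F (e j))) {..<n}"
      by (rule L2_set_right_distrib[symmetric]) simp
    also have "\<dots> \<le> norm T * hilbert_schmidt_norm e F"
      by (intro mult_left_mono hilbert_schmidt_partial_le F) simp
    finally show "L2_set (\<lambda>j. norm ((T o\<^sub>L F) (e j))) {..<n} \<le> norm T * hilbert_schmidt_norm e F" .
  qed
  show "norm (F (e 0)) \<le> hilbert_schmidt_norm e F" if "F \<in> hilbert_schmidt_ops e" for F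
    using hilbert_schmidt_partial_le[OF that, of 1] by (simp add: L2_set_def)
  show "\<exists>m. hilbert_schmidt_norm e (F - (F o\<^sub>L proj m)) < \<epsilon>"
    if F: "F \<in> hilbert_schmidt_ops e" and \<epsilon>: "\<epsilon> > 0" for F \<epsilon>
  proof -
    have "summable (\<lambda>j. (norm (F (e j)))\<^sup>2)" using F by (simp add: hilbert_schmidt_ops_def)
    moreover have "(\<epsilon> / 2)\<^sup>2 > 0" using \<epsilon> by simp
    ultimately obtain m where m: "\<And>n. norm (\<Sum>j=m..<n. (norm (F (e j)))\<^sup>2) < (\<epsilon> / 2)\<^sup>2"
      unfolding summable_Cauchy by blast
    have "hilbert_schmidt_norm e (F - (F o\<^sub>L proj m)) \<le> \<epsilon> / 2"
    proof (rule hilbert_schmidt_boundI)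
      show "F - (F o\<^sub>L proj m) \<in> bounded_ops"
        by (intro bounded_ops_diff bounded_ops_compose bdd F proj_bounded_ops)
      fix n
      have "(\<Sum>j<n. (norm ((F - (F o\<^sub>L proj m)) (e j)))\<^sup>2) = (\<Sum>j=m..<n. (norm (F (e j)))\<^sup>2)"
        by (intro sum.mono_neutral_cong_right) (auto simp: blinfun.diff_left proj_basis)
      also have "\<dots> \<le> (\<epsilon> / 2)\<^sup>2" using m[of n] by simp
      finally show "L2_set (\<lambda>j. norm ((F - (F o\<^sub>L proj m)) (e j))) {..<n} \<le> \<epsilon> / 2"
        unfolding L2_set_def using \<epsilon> by (intro real_le_lsqrt) auto
    qed
    then show ?thesis using \<epsilon> by (intro exI[of _ m]) simp
  qed
qed

section \<open>Compact operators\<close>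

lemma compact_opsI:
  assumes "F \<in> bounded_ops" "compact K" "\<And>x. norm x \<le> 1 \<Longrightarrow> F x \<in> K"
  shows "F \<in> compact_ops"
proof -
  have "closure (blinfun_apply F ` cball 0 1) \<subseteq> K"
    using assms by (intro closure_minimal compact_imp_closed) auto
  then have "closure (blinfun_apply F ` cball 0 1) = K \<inter> closure (blinfun_apply F ` cball 0 1)"
    by blast
  moreover have "compact (K \<inter> closure (blinfun_apply F ` cball 0 1))"
    by (intro compact_Int_closed assms) simp
  ultimately show ?thesis using assms(1) by (simp add: compact_ops_def)
qed

lemma compact_opsD:
  assumes "F \<in> compact_ops"
  obtains K where "compact K" "\<And>x. norm x \<le> 1 \<Longrightarrow> F x \<in> K"
proof (rule that)
  show "compact (closure (blinfun_apply F ` cball 0 1))" using assms by (simp add: compact_ops_def)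
  show "F x \<in> closure (blinfun_apply F ` cball 0 1)" if "norm x \<le> 1" for x
    using that by (intro subsetD[OF closure_subset]) simp
qed

lemma compact_ops_add:
  assumes "F \<in> compact_ops" "G \<in> compact_ops" shows "F + G \<in> compact_ops"
proof -
  obtain K where K: "compact K" "\<And>x. norm x \<le> 1 \<Longrightarrow> F x \<in> K" using compact_opsD[OF assms(1)] by blast
  obtain L where L: "compact L" "\<And>x. norm x \<le> 1 \<Longrightarrow> G x \<in> L" using compact_opsD[OF assms(2)] by blast
  show ?thesis
  proof (rule compact_opsI)
    show "F + G \<in> bounded_ops" using assms by (simp add: compact_ops_def bounded_ops_add)
    show "compact {x + y | x y. x \<in> K \<and> y \<in> L}" by (rule compact_sums[OF K(1) L(1)])
  qed (use K L in \<open>auto simp: blinfun.add_left\<close>)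
qed

lemma compact_ops_rank_one: "rank_one y (e j) \<in> compact_ops"
proof (rule compact_opsI[OF rank_one_bounded_ops])
  have "bounded_linear (\<lambda>c. c *\<^sub>C y)"
    by (rule bounded_linear_intro[where K = "norm y"])
       (simp_all add: scaleC_add_left scaleR_scaleC scaleC_scaleC norm_scaleC scaleR_conv_of_real)
  then show "compact ((\<lambda>c. c *\<^sub>C y) ` cball 0 1)"
    by (intro compact_continuous_image linear_continuous_on compact_cball)
  show "rank_one y (e j) x \<in> (\<lambda>c. c *\<^sub>C y) ` cball 0 1" if "norm x \<le> 1" for x
    using order_trans[OF cmod_cinner_basis_le that, of j] by (auto simp: rank_one_apply)
qed

lemma compact_ops_cols: "cols m y \<in> compact_ops"
  unfolding cols_def
proof (induction m)
  case 0
  show ?case by (rule compact_opsI[of _ "{0}"]) (simp_all add: bounded_ops_0)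
qed (simp add: compact_ops_add compact_ops_rank_one)

text \<open>
  If truncation did not come close in norm, there would be vectors \<open>x m\<close> in the unit ball with
  \<open>F (x m - proj m (x m))\<close> bounded away from \<open>0\<close>. This sequence tends weakly to \<open>0\<close>, which
  contradicts the existence of a norm-convergent subsequence.
\<close>

lemma compact_ops_proj_approx:
  fixes F :: "'h \<Rightarrow>\<^sub>L 'h"
  assumes F: "F \<in> compact_ops" and "\<epsilon> > 0"
  shows "\<exists>m. norm (F - (F o\<^sub>L proj m)) < \<epsilon>"
proof (rule ccontr)
  assume "\<not> ?thesis"
  then have ge: "norm (F - (F o\<^sub>L proj m)) \<ge> \<epsilon>" for m by (simp add: not_less)
  have Fb: "F \<in> bounded_ops" using F by (simp add: compact_ops_def)
  have "\<exists>x. norm x \<le> 1 \<and> norm (F (x - proj m x)) > \<epsilon> / 2" for m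
  proof -
    have "\<not> (\<forall>x. norm ((F - (F o\<^sub>L proj m)) x) \<le> \<epsilon> / 2 * norm x)"
      using norm_blinfun_bound[of "\<epsilon> / 2" "F - (F o\<^sub>L proj m)"] ge[of m] \<open>\<epsilon> > 0\<close> by fastforce
    then obtain x where x: "norm (F (x - proj m x)) > \<epsilon> / 2 * norm x"
      by (auto simp: blinfun.bilinear_simps not_le)
    then have "x \<noteq> 0" by auto
    let ?x = "(1 / norm x) *\<^sub>R x"
    have "F (?x - proj m ?x) = (1 / norm x) *\<^sub>R F (x - proj m x)"
      by (simp add: blinfun.bilinear_simps scaleR_diff_right)
    then have "norm (F (?x - proj m ?x)) > \<epsilon> / 2"
      using x \<open>x \<noteq> 0\<close> by (simp add: field_simps)
    moreover have "norm ?x \<le> 1" using \<open>x \<noteq> 0\<close> by simp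
    ultimately show ?thesis by blast
  qed
  then obtain x where x: "\<And>m. norm (x m) \<le> 1" "\<And>m. norm (F (x m - proj m (x m))) > \<epsilon> / 2"
    by metis
  define z where "z m = F (x m - proj m (x m))" for m
  obtain K where K: "compact K" "\<And>x. norm x \<le> 1 \<Longrightarrow> F x \<in> K" using compact_opsD[OF F] by blast
  have "\<forall>m. z m \<in> K"
    using K(2) x(1) norm_diff_proj_le order_trans unfolding z_def by blast
  then obtain w r where r: "strict_mono r" and w: "(z \<circ> r) \<longlonglongrightarrow> w"
    using compact_imp_seq_compact[OF K(1)] by (metis seq_compactE)
  let ?y = "adjoint_op F w"
  have weak: "cmod (cinner (z m) w) \<le> norm (?y - proj m ?y)" for m
  proof -
    have "cinner (z m) w = cinner (x m - proj m (x m)) ?y"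
      by (simp only: z_def adjoint_op_cinner[OF Fb])
    also have "\<dots> = cinner (x m) (?y - proj m ?y)"
      by (simp only: cinner_diff_left cinner_diff_right proj_sym)
    finally have "cmod (cinner (z m) w) \<le> norm (x m) * norm (?y - proj m ?y)"
      using cinner_Cauchy_Schwarz by metis
    also have "\<dots> \<le> 1 * norm (?y - proj m ?y)" by (intro mult_right_mono x(1)) simp
    finally show ?thesis by simp
  qed
  have "(\<lambda>m. norm (?y - proj m ?y)) \<longlonglongrightarrow> 0"
    using tendsto_norm[OF tendsto_diff[OF tendsto_const[of ?y] proj_tendsto[of ?y]]] by simp
  then have "(\<lambda>m. cinner (z m) w) \<longlonglongrightarrow> 0"
    by (rule Lim_null_comparison[rotated]) (simp add: weak)
  then have "(\<lambda>k. cinner ((z \<circ> r) k) w) \<longlonglongrightarrow> 0"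
    using LIMSEQ_subseq_LIMSEQ[OF _ r] by (simp add: o_def)
  moreover have "(\<lambda>k. cinner ((z \<circ> r) k) w) \<longlonglongrightarrow> cinner w w"
    by (intro tendsto_cinner w tendsto_const)
  ultimately have "cinner w w = 0" using LIMSEQ_unique by blast
  then have "w = 0" by (simp add: cinner_self)
  have "\<epsilon> / 2 \<le> norm w"
    using x(2) by (intro tendsto_lowerbound[OF tendsto_norm[OF w]]) (auto simp: z_def less_imp_le)
  then show False using \<open>w = 0\<close> \<open>\<epsilon> > 0\<close> by simp
qed

lemma compact_ideal: "normed_left_ideal e compact_ops norm"
proof unfold_locales
  show bdd: "F \<in> bounded_ops" if "F \<in> compact_ops" for F :: "'h \<Rightarrow>\<^sub>L 'h"
    using that by (simp add: compact_ops_def)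
  show "F \<in> compact_ops" "norm F \<le> (\<Sum>j<m. norm (F (e j)))"
    if "F \<in> bounded_ops" and "\<And>j. j \<ge> m \<Longrightarrow> F (e j) = 0" for F m
    using bounded_ops_finite_cols[OF that] compact_ops_cols norm_cols_le by metis+
  show "F + G \<in> compact_ops" if "F \<in> compact_ops" "G \<in> compact_ops" for F G :: "'h \<Rightarrow>\<^sub>L 'h"
    by (rule compact_ops_add[OF that])
  show "T o\<^sub>L F \<in> compact_ops" if T: "T \<in> bounded_ops" and F: "F \<in> compact_ops" for T F :: "'h \<Rightarrow>\<^sub>L 'h"
  proof -
    obtain K where K: "compact K" "\<And>x. norm x \<le> 1 \<Longrightarrow> F x \<in> K" using compact_opsD[OF F] by blast
    show ?thesis
    proof (rule compact_opsI)
      show "T o\<^sub>L F \<in> bounded_ops" by (intro bounded_ops_compose T bdd F)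
      show "compact (blinfun_apply T ` K)"
        by (intro compact_continuous_image K continuous_intros)
    qed (use K in auto)
  qed
  show "norm (F (e 0)) \<le> norm F" for F :: "'h \<Rightarrow>\<^sub>L 'h"
    using norm_blinfun[of F "e 0"] by simp
  show "\<exists>m. norm (F - (F o\<^sub>L proj m)) < \<epsilon>" if "F \<in> compact_ops" "\<epsilon> > 0" for F \<epsilon>
    by (rule compact_ops_proj_approx[OF that])
qed (rule norm_triangle_ineq)

section \<open>Trace class operators\<close>

text \<open>
  With \<open>Q\<close> the square root of \<open>P\<close>, this says that the Hilbert--Schmidt norm of \<open>Q \<circ> D\<close> is at
  most that of \<open>Q\<close>, seen by expanding in the basis and passing to the adjoints.
\<close>

lemma trace_compression_le:
  assumes P: "positive_op P" and summ: "summable (\<lambda>j. Re (cinner (P (e j)) (e j)))"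
    and D: "D \<in> bounded_ops" "\<And>x. norm (adjoint_op D x) \<le> norm x" and J: "finite J"
  shows "(\<Sum>j\<in>J. Re (cinner (P (D (e j))) (D (e j)))) \<le> (\<Sum>j. Re (cinner (P (e j)) (e j)))"
proof -
  obtain Q where Q: "positive_op Q" "Q o\<^sub>L Q = P" using positive_sqrt_exists[OF P] by blast
  have norm_Q: "(norm (Q x))\<^sup>2 = Re (cinner (P x) x)" for x
  proof -
    have "cinner (Q x) (Q x) = cinner (P x) x"
      using positive_op_sym[OF Q(1), of "Q x" x] Q(2) by (metis blinfun_apply_blinfun_compose)
    then show ?thesis by (metis cinner_self Re_complex_of_real)
  qed
  have sums: "(\<lambda>i. \<Sum>j\<in>J. (cmod (cinner (Q (D (e j))) (e i)))\<^sup>2) sums (\<Sum>j\<in>J. (norm (Q (D (e j))))\<^sup>2)"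
    by (intro sums_sum Parseval)
  have le: "(\<Sum>j\<in>J. (cmod (cinner (Q (D (e j))) (e i)))\<^sup>2) \<le> Re (cinner (P (e i)) (e i))" for i
  proof -
    have "cmod (cinner (Q (D (e j))) (e i)) = cmod (cinner (adjoint_op D (Q (e i))) (e j))" for j
    proof -
      have "cinner (Q (D (e j))) (e i) = cinner (e j) (adjoint_op D (Q (e i)))"
        by (simp only: positive_op_sym[OF Q(1)] adjoint_op_cinner[OF D(1)])
      also have "cmod \<dots> = cmod (cinner (adjoint_op D (Q (e i))) (e j))"
        by (metis cinner_commute complex_mod_cnj)
      finally show ?thesis .
    qed
    then have "(\<Sum>j\<in>J. (cmod (cinner (Q (D (e j))) (e i)))\<^sup>2) \<le> (norm (adjoint_op D (Q (e i))))\<^sup>2"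
      using Bessel[OF J, of "adjoint_op D (Q (e i))"] by simp
    also have "\<dots> \<le> (norm (Q (e i)))\<^sup>2" by (intro power_mono D(2)) simp
    finally show ?thesis by (simp add: norm_Q)
  qed
  have "(\<Sum>j\<in>J. (norm (Q (D (e j))))\<^sup>2) \<le> (\<Sum>j. Re (cinner (P (e j)) (e j)))"
    by (rule sums_le[OF le sums summable_sums[OF summ]])
  then show ?thesis by (simp add: norm_Q)
qed

lemma adjoint_contraction:
  fixes C :: "'h \<Rightarrow>\<^sub>L 'h"
  assumes "C \<in> bounded_ops" "\<And>x. norm (C x) \<le> norm x"
  shows "norm (adjoint_op C x) \<le> norm x"
proof -
  have "norm C \<le> 1" by (rule norm_blinfun_bound) (simp_all add: assms(2))
  then have "norm (adjoint_op C) \<le> 1" using norm_adjoint_le[OF assms(1)] by linarith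
  then show ?thesis using norm_blinfun_le by fastforce
qed

text \<open>
  The trace norm of \<open>F\<close> is the supremum of \<open>Re (\<Sum>j<n. \<langle>F e\<^sub>j, C e\<^sub>j\<rangle>)\<close> over all \<open>n\<close> and all
  contractions \<open>C\<close>. The next two lemmas are the two halves, the first one in a form that also
  controls tails.
\<close>

lemma trace_class_pairing_le:
  fixes F C :: "'h \<Rightarrow>\<^sub>L 'h"
  assumes F: "F \<in> trace_class_ops e"
    and C: "C \<in> bounded_ops" "\<And>x. norm (C x) \<le> norm x" and J: "finite J"
  shows "(\<Sum>j\<in>J. Re (cinner (F (e j)) (C (e j))))
    \<le> sqrt (\<Sum>j\<in>J. Re (cinner (abs_op F (e j)) (e j))) * sqrt (trace_norm e F)" (is "?l \<le> ?r")
proof (rule field_le_epsilon)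
  fix \<delta> :: real assume "\<delta> > 0"
  define \<epsilon> where "\<epsilon> = \<delta> / (real (card J) + 1)"
  have \<epsilon>: "\<epsilon> > 0" "real (card J) * \<epsilon> \<le> \<delta>" using \<open>\<delta> > 0\<close> by (simp_all add: \<epsilon>_def field_simps)
  let ?P = "abs_op F"
  have Fb: "F \<in> bounded_ops" and summ: "summable (\<lambda>j. Re (cinner (?P (e j)) (e j)))"
    using F by (simp_all add: trace_class_ops_def)
  note P = positive_abs_op[OF Fb]
  obtain U where U: "U \<in> bounded_ops" "\<And>x. norm (U x) \<le> norm x"
    "\<And>x. F x = U (?P x) + \<epsilon> *\<^sub>R U x"
    using approximate_polar_decomposition[OF Fb \<epsilon>(1)] by metis
  let ?D = "adjoint_op U o\<^sub>L C"
  have D: "?D \<in> bounded_ops" by (intro bounded_ops_compose adjoint_op_bounded_ops U C)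
  have "norm (?D x) \<le> norm x" for x
    using order_trans[OF adjoint_contraction[OF U(1,2), of "C x"] C(2)] by simp
  then have D': "norm (adjoint_op ?D x) \<le> norm x" for x by (rule adjoint_contraction[OF D])
  let ?f = "\<lambda>j. sqrt (Re (cinner (?P (e j)) (e j)))"
  let ?g = "\<lambda>j. sqrt (Re (cinner (?P (?D (e j))) (?D (e j))))"
  have "Re (cinner (F (e j)) (C (e j))) \<le> \<bar>?f j\<bar> * \<bar>?g j\<bar> + \<epsilon>" for j
  proof -
    have "cinner (F (e j)) (C (e j)) = cinner (?P (e j)) (?D (e j)) + complex_of_real \<epsilon> * cinner (U (e j)) (C (e j))"
      by (subst U(3)) (simp add: cinner_simps adjoint_op_cinner[OF U(1)])
    then have eq: "Re (cinner (F (e j)) (C (e j)))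
        = Re (cinner (?P (e j)) (?D (e j))) + \<epsilon> * Re (cinner (U (e j)) (C (e j)))"
      by simp
    have "Re (cinner (?P (e j)) (?D (e j))) \<le> cmod (cinner (?P (e j)) (?D (e j)))"
      by (rule complex_Re_le_cmod)
    also have "\<dots> \<le> sqrt (Re (cinner (?P (e j)) (e j)) * Re (cinner (?P (?D (e j))) (?D (e j))))"
      by (rule real_le_rsqrt) (rule positive_op_Cauchy_Schwarz[OF P])
    also have "\<dots> = \<bar>?f j\<bar> * \<bar>?g j\<bar>"
      by (simp add: real_sqrt_mult positive_op_ge_0[OF P])
    finally have "Re (cinner (?P (e j)) (?D (e j))) \<le> \<bar>?f j\<bar> * \<bar>?g j\<bar>" .
    moreover have "Re (cinner (U (e j)) (C (e j))) \<le> 1"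
      using Re_cinner_le[of "U (e j)" "C (e j)"] mult_mono[OF U(2)[of "e j"] C(2)[of "e j"]] by simp
    then have "\<epsilon> * Re (cinner (U (e j)) (C (e j))) \<le> \<epsilon> * 1"
      using \<epsilon>(1) by (intro mult_left_mono) auto
    ultimately show ?thesis unfolding eq by linarith
  qed
  then have "?l \<le> (\<Sum>j\<in>J. \<bar>?f j\<bar> * \<bar>?g j\<bar> + \<epsilon>)" by (intro sum_mono)
  also have "\<dots> = (\<Sum>j\<in>J. \<bar>?f j\<bar> * \<bar>?g j\<bar>) + real (card J) * \<epsilon>"
    by (simp add: sum.distrib)
  also have "(\<Sum>j\<in>J. \<bar>?f j\<bar> * \<bar>?g j\<bar>) \<le> L2_set ?f J * L2_set ?g J"
    by (rule L2_set_mult_ineq)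
  also have "\<dots> \<le> ?r"
  proof (rule mult_mono)
    show "L2_set ?f J \<le> sqrt (\<Sum>j\<in>J. Re (cinner (?P (e j)) (e j)))"
      by (simp add: L2_set_def positive_op_ge_0[OF P])
    show "L2_set ?g J \<le> sqrt (trace_norm e F)"
      using trace_compression_le[OF P summ D D' J]
      by (simp add: L2_set_def positive_op_ge_0[OF P] trace_norm_def)
  qed (auto intro!: sum_nonneg positive_op_ge_0[OF P])
  finally show "?l \<le> ?r + \<delta>" using \<epsilon>(2) by simp
qed

lemma trace_class_boundI:
  fixes F :: "'h \<Rightarrow>\<^sub>L 'h"
  assumes F: "F \<in> bounded_ops"
    and le: "\<And>C n. C \<in> bounded_ops \<Longrightarrow> (\<And>x. norm (blinfun_apply C x) \<le> norm x) \<Longrightarrow>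
      (\<Sum>j<n. Re (cinner (F (e j)) (C (e j)))) \<le> K"
  shows "F \<in> trace_class_ops e" "trace_norm e F \<le> K"
proof -
  let ?p = "\<lambda>j. Re (cinner (abs_op F (e j)) (e j))"
  have part: "(\<Sum>j<n. ?p j) \<le> K" for n
  proof (rule field_le_epsilon)
    fix \<delta> :: real assume "\<delta> > 0"
    define \<epsilon> where "\<epsilon> = \<delta> / (real n + 1)"
    have \<epsilon>: "\<epsilon> > 0" "real n * \<epsilon> \<le> \<delta>" using \<open>\<delta> > 0\<close> by (simp_all add: \<epsilon>_def field_simps)
    obtain U where U: "U \<in> bounded_ops" "\<And>x. norm (U x) \<le> norm x"
      "\<And>x. Re (cinner (abs_op F x) x) \<le> Re (cinner (F x) (U x)) + \<epsilon> * (norm x)\<^sup>2"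
      using approximate_polar_decomposition[OF F \<epsilon>(1)] by metis
    have "(\<Sum>j<n. ?p j) \<le> (\<Sum>j<n. Re (cinner (F (e j)) (U (e j))) + \<epsilon>)"
      using U(3)[of "e _"] by (intro sum_mono) simp
    also have "\<dots> = (\<Sum>j<n. Re (cinner (F (e j)) (U (e j)))) + real n * \<epsilon>"
      by (simp add: sum.distrib)
    finally show "(\<Sum>j<n. ?p j) \<le> K + \<delta>" using le[OF U(1,2), of n] \<epsilon>(2) by linarith
  qed
  have summ: "summable ?p"
    by (rule bounded_imp_summable[where B = K])
       (simp_all only: positive_op_ge_0[OF positive_abs_op[OF F]] lessThan_Suc_atMost[symmetric] part)
  then show "F \<in> trace_class_ops e" using F by (simp add: trace_class_ops_def)
  show "trace_norm e F \<le> K"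
    unfolding trace_norm_def by (rule suminf_le_const[OF summ part])
qed

lemma trace_class_pairing_le_norm:
  fixes F C :: "'h \<Rightarrow>\<^sub>L 'h"
  assumes F: "F \<in> trace_class_ops e"
    and C: "C \<in> bounded_ops" "\<And>x. norm (C x) \<le> norm x" and J: "finite J"
  shows "(\<Sum>j\<in>J. Re (cinner (F (e j)) (C (e j)))) \<le> trace_norm e F"
proof -
  have Fb: "F \<in> bounded_ops" and summ: "summable (\<lambda>j. Re (cinner (abs_op F (e j)) (e j)))"
    using F by (simp_all add: trace_class_ops_def)
  note pos = positive_op_ge_0[OF positive_abs_op[OF Fb]]
  have le: "(\<Sum>j\<in>J. Re (cinner (abs_op F (e j)) (e j))) \<le> trace_norm e F"
    unfolding trace_norm_def by (rule sum_le_suminf[OF summ J]) (rule pos)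
  have "trace_norm e F \<ge> 0"
    unfolding trace_norm_def by (rule suminf_nonneg[OF summ]) (rule pos)
  have "(\<Sum>j\<in>J. Re (cinner (F (e j)) (C (e j)))) \<le> sqrt (trace_norm e F) * sqrt (trace_norm e F)"
    by (rule order_trans[OF trace_class_pairing_le[OF assms]])
       (intro mult_right_mono real_sqrt_le_mono le, simp add: \<open>trace_norm e F \<ge> 0\<close>)
  then show ?thesis using \<open>trace_norm e F \<ge> 0\<close> by simp
qed

lemma trace_class_ideal: "normed_left_ideal e (trace_class_ops e) (trace_norm e)"
proof unfold_locales
  show bdd: "F \<in> bounded_ops" if "F \<in> trace_class_ops e" for F
    using that by (simp add: trace_class_ops_def)
  show "F \<in> trace_class_ops e" "trace_norm e F \<le> (\<Sum>j<m. norm (F (e j)))"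
    if F: "F \<in> bounded_ops" and 0: "\<And>j. j \<ge> m \<Longrightarrow> F (e j) = 0" for F m
  proof -
    have "(\<Sum>j<n. Re (cinner (F (e j)) (C (e j)))) \<le> (\<Sum>j<m. norm (F (e j)))"
      if "C \<in> bounded_ops" and C: "\<And>x. norm (blinfun_apply C x) \<le> norm x" for C :: "'h \<Rightarrow>\<^sub>L 'h" and n
    proof -
      have "Re (cinner (F (e j)) (C (e j))) \<le> norm (F (e j))" for j
        using Re_cinner_le[of "F (e j)" "C (e j)"] mult_left_mono[OF C[of "e j"], of "norm (F (e j))"]
        by simp
      then have "(\<Sum>j<n. Re (cinner (F (e j)) (C (e j)))) \<le> (\<Sum>j<n. norm (F (e j)))"
        by (intro sum_mono)
      also have "\<dots> \<le> (\<Sum>j<m. norm (F (e j)))" by (rule sum_norm_cols_le[OF 0])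
      finally show ?thesis .
    qed
    then show "F \<in> trace_class_ops e" "trace_norm e F \<le> (\<Sum>j<m. norm (F (e j)))"
      using trace_class_boundI[OF F] by blast+
  qed
  show "F + G \<in> trace_class_ops e" "trace_norm e (F + G) \<le> trace_norm e F + trace_norm e G"
    if FG: "F \<in> trace_class_ops e" "G \<in> trace_class_ops e" for F G
  proof -
    have "(\<Sum>j<n. Re (cinner ((F + G) (e j)) (C (e j)))) \<le> trace_norm e F + trace_norm e G"
      if "C \<in> bounded_ops" "\<And>x. norm (blinfun_apply C x) \<le> norm x" for C :: "'h \<Rightarrow>\<^sub>L 'h" and n
      using add_mono[OF trace_class_pairing_le_norm[OF FG(1) that, of "{..<n}"]
          trace_class_pairing_le_norm[OF FG(2) that, of "{..<n}"]]
      by (simp add: blinfun.add_left cinner_add_left sum.distrib)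
    then show "F + G \<in> trace_class_ops e" "trace_norm e (F + G) \<le> trace_norm e F + trace_norm e G"
      using trace_class_boundI[OF bounded_ops_add[OF bdd[OF FG(1)] bdd[OF FG(2)]]] by blast+
  qed
  show "T o\<^sub>L F \<in> trace_class_ops e" if T: "T \<in> bounded_ops" and F: "F \<in> trace_class_ops e" for T F
  proof (rule trace_class_boundI)
    show "T o\<^sub>L F \<in> bounded_ops" by (intro bounded_ops_compose T bdd F)
    fix C :: "'h \<Rightarrow>\<^sub>L 'h" and n
    assume C: "C \<in> bounded_ops" "\<And>x. norm (C x) \<le> norm x"
    \<comment> \<open>The summand \<open>1\<close> keeps the scaling factor nonzero when \<open>T = 0\<close>.\<close>
    define a where "a = norm T + 1"
    have a: "a > 0" by (simp add: a_def add_nonneg_pos)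
    let ?C = "(1 / a) *\<^sub>R (adjoint_op T o\<^sub>L C)"
    have "norm (?C x) \<le> norm x" for x
    proof -
      have "norm (adjoint_op T (C x)) \<le> a * norm (C x)"
        using norm_adjoint_le[OF T] by (intro norm_blinfun_le) (simp add: a_def)
      also have "\<dots> \<le> a * norm x" using C(2) a by (intro mult_left_mono) auto
      finally show ?thesis using a by (simp add: blinfun.scaleR_left field_simps)
    qed
    moreover have "?C \<in> bounded_ops"
      by (intro bounded_ops_scaleR bounded_ops_compose adjoint_op_bounded_ops T C)
    ultimately have "(\<Sum>j<n. Re (cinner (F (e j)) (?C (e j)))) \<le> trace_norm e F"
      by (intro trace_class_pairing_le_norm[OF F]) auto
    moreover have "Re (cinner ((T o\<^sub>L F) (e j)) (C (e j))) = a * Re (cinner (F (e j)) (?C (e j)))" for j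
      using a by (simp add: blinfun.scaleR_left cinner_scaleR_right adjoint_op_cinner[OF T])
    ultimately show "(\<Sum>j<n. Re (cinner ((T o\<^sub>L F) (e j)) (C (e j)))) \<le> a * trace_norm e F"
      using a by (simp add: sum_distrib_left[symmetric])
  qed
  show "norm (F (e 0)) \<le> trace_norm e F" if F: "F \<in> trace_class_ops e" for F
  proof (cases "F (e 0) = 0")
    case True
    then show ?thesis
      using trace_class_pairing_le_norm[OF F bounded_ops_id, of "{}"] by simp
  next
    case False
    \<comment> \<open>Pair \<open>F\<close> with the contraction \<open>x \<mapsto> \<langle>x, e 0\<rangle> y\<close>.\<close>
    define y where "y = (1 / norm (F (e 0))) *\<^sub>R F (e 0)"
    have y: "norm y = 1" using False by (simp add: y_def)
    have "norm (rank_one y (e 0) x) \<le> norm x" for x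
      by (simp add: rank_one_apply norm_scaleC y cmod_cinner_basis_le)
    from trace_class_pairing_le_norm[OF F rank_one_bounded_ops this, of "{0}"]
    have "Re (cinner (F (e 0)) y) \<le> trace_norm e F"
      by (simp add: rank_one_apply cinner_basis scaleC_one)
    moreover have "cinner (F (e 0)) y = norm (F (e 0))"
      using False by (simp add: y_def cinner_scaleR_right cinner_self power2_eq_square)
    ultimately show ?thesis by simp
  qed
  show "\<exists>m. trace_norm e (F - (F o\<^sub>L proj m)) < \<epsilon>"
    if F: "F \<in> trace_class_ops e" and \<epsilon>: "\<epsilon> > 0" for F \<epsilon>
  proof -
    let ?p = "\<lambda>j. Re (cinner (abs_op F (e j)) (e j))"
    define s where "s = sqrt (trace_norm e F)"
    have s: "s \<ge> 0"
      using trace_class_pairing_le_norm[OF F bounded_ops_id, of "{}"] by (simp add: s_def)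
    define \<delta> where "\<delta> = \<epsilon> / (2 * (s + 1))"
    have \<delta>: "\<delta> > 0" "\<delta> * s \<le> \<epsilon> / 2"
      using \<epsilon> s by (simp_all add: \<delta>_def field_simps)
    have "summable ?p" using F by (simp add: trace_class_ops_def)
    moreover have "\<delta>\<^sup>2 > 0" using \<delta>(1) by simp
    ultimately obtain m where m: "\<And>n. norm (\<Sum>j=m..<n. ?p j) < \<delta>\<^sup>2"
      unfolding summable_Cauchy by blast
    have "trace_norm e (F - (F o\<^sub>L proj m)) \<le> \<epsilon> / 2"
    proof (rule trace_class_boundI)
      show "F - (F o\<^sub>L proj m) \<in> bounded_ops"
        by (intro bounded_ops_diff bounded_ops_compose bdd F proj_bounded_ops)
      fix C :: "'h \<Rightarrow>\<^sub>L 'h" and n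
      assume C: "C \<in> bounded_ops" "\<And>x. norm (C x) \<le> norm x"
      have "(\<Sum>j<n. Re (cinner ((F - (F o\<^sub>L proj m)) (e j)) (C (e j))))
          = (\<Sum>j=m..<n. Re (cinner (F (e j)) (C (e j))))"
        by (intro sum.mono_neutral_cong_right) (auto simp: blinfun.diff_left proj_basis)
      also have "\<dots> \<le> sqrt (\<Sum>j=m..<n. ?p j) * s"
        unfolding s_def by (rule trace_class_pairing_le[OF F C]) simp
      also have "\<dots> \<le> \<delta> * s"
      proof (rule mult_right_mono[OF _ s])
        have "(\<Sum>j=m..<n. ?p j) \<le> \<delta>\<^sup>2" using m[of n] by (simp add: abs_less_iff)
        then show "sqrt (\<Sum>j=m..<n. ?p j) \<le> \<delta>" using \<delta>(1) by (intro real_le_lsqrt) auto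
      qed
      finally show "(\<Sum>j<n. Re (cinner ((F - (F o\<^sub>L proj m)) (e j)) (C (e j)))) \<le> \<epsilon> / 2"
        using \<delta>(2) by linarith
    qed
    then show ?thesis using \<epsilon> by (intro exI[of _ m]) simp
  qed
qed

end

section \<open>The criterion for left multipliers\<close>

theorem corollary2p15:
  fixes e :: "nat \<Rightarrow> 'h::complex_hilbert"
    and W :: "nat \<Rightarrow> ('h \<Rightarrow>\<^sub>L 'h)"
    and r :: "nat \<Rightarrow> nat"
    and N :: nat
    and \<B> :: "('h \<Rightarrow>\<^sub>L 'h) set"
    and \<nu> :: "('h \<Rightarrow>\<^sub>L 'h) \<Rightarrow> real"
  assumes "orthonormal_basis e"
    and "N \<ge> 2"
    and "\<And>l. l \<in> {1..N} \<Longrightarrow> W l \<in> bounded_ops"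
    and "\<And>l. l \<in> {1..N} \<Longrightarrow> invertible_op (W l)"
    and "mono_on {1..N} r"
    and "(\<B>, \<nu>) \<in> {(compact_ops, norm), (trace_class_ops e, trace_norm e),
                     (hilbert_schmidt_ops e, hilbert_schmidt_norm e)}"
  shows "d_hypercyclicity_criterion \<B> \<nu> N (\<lambda>l. left_multiplier (op_power (W l) (r l)))
     \<longleftrightarrow> d_hypercyclicity_criterion (UNIV :: 'h set) norm N
           (\<lambda>l. blinfun_apply (op_power (W l) (r l)))"
proof -
  interpret hilbert_basis e by unfold_locales (rule assms(1))
  interpret normed_left_ideal e \<B> \<nu>
    using assms(6) compact_ideal trace_class_ideal hilbert_schmidt_ideal by auto
  have "op_power (W l) (r l) \<in> bounded_ops" if "l \<in> {1..N}" for l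
    using assms(3)[OF that] by (rule bounded_ops_op_power)
  then show ?thesis
    using criterion_from_multipliers[where N = N and T = "\<lambda>l. op_power (W l) (r l)"]
      criterion_to_multipliers[where N = N and T = "\<lambda>l. op_power (W l) (r l)"] by blast
qed

end
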